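(* Let $(\mathcal{C},\mathbb{E},\mathfrak{s})$ be a weakly idempotent complete extriangulated category and let $(\mathcal{U},\mathcal{V})$ be a pair of classes of objects in $\mathcal{C}$. Then the following are equivalent: (1) $(\mathcal{U},\mathcal{V})$ is a hereditary cotorsion pair on $\mathcal{C}$; (2) $(\mathrm{Infl}\,\mathcal{U},\mathrm{Defl}\,\mathcal{V})$ is an admissible weak factorization system such that $\mathrm{Infl}\,\mathcal{U}$ satisfies the left cancellation property; (3) $(\mathrm{Infl}\,\mathcal{U},\mathrm{Defl}\,\mathcal{V})$ is an admissible weak factorization system such that $\mathrm{Defl}\,\mathcal{V}$ satisfies the right cancellation property.
   Context: **Extriangulated categories (Nakaoka–Palu).** Let $\mathcal{C}$ be an additive category and $\mathbb{E}:\mathcal{C}^{\rm op}\times\mathcal{C}\to\mathrm{Ab}$ an additive bifunctor; elements $\delta\in\mathbb{E}(C,A)$ are called $\mathbb{E}$-extensions. For $a:A\to A'$, $c:C'\to C$ write $a_*\delta=\mathbb{E}(C,a)(\delta)$ and $c^*\delta=\mathbb{E}(c,A)(\delta)$. A morphism from $\delta\in\mathbb{E}(C,A)$ to $\delta'\in\mathbb{E}(C',A')$ is a pair $(a:A\to A',\,c:C\to C')$ with $a_*\delta=c^*\delta'$. Sequences $A\xrightarrow{x}B\xrightarrow{y}C$ and $A\xrightarrow{x'}B'\xrightarrow{y'}C$ are equivalent if there is an isomorphism $b:B\to B'$ with $bx=x'$, $y'b=y$. A realization $\mathfrak{s}$ assigns to each $\delta\in\mathbb{E}(C,A)$ an equivalence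 class $\mathfrak{s}(\delta)=[A\xrightarrow{x}B\xrightarrow{y}C]$ such that for every morphism $(a,c):\delta\to\delta'$ with $\mathfrak{s}(\delta')=[A'\xrightarrow{x'}B'\xrightarrow{y'}C']$ there is $b:B\to B'$ with $bx=x'a$ and $y'b=cy$. It is additive if $\mathfrak{s}(0)=[A\to A\oplus C\to C]$ (canonical maps) and $\mathfrak{s}(\delta\oplus\delta')=\mathfrak{s}(\delta)\oplus\mathfrak{s}(\delta')$. The triple $(\mathcal{C},\mathbb{E},\mathfrak{s})$ is an extriangulated category if $\mathfrak{s}$ is an additive realization and: (ET3) if $\delta,\delta'$ are realized by $A\xrightarrow{x}B\xrightarrow{y}C$ and $A'\xrightarrow{x'}B'\xrightarrow{y'}C'$ and $bx=x'a$, there is $c:C\to C'$ with $cy=y'b$ and $a_*\delta=c^*\delta'$; (ET3)$^{\rm op}$ dually, if $cy=y'b$, there is $a$ with $bx=x'a$ and $a_*\delta=c^*\delta'$; (ET4) if $\delta\in\mathbb{E}(D,A)$ is realized by $A\xrightarrow{f}B\xrightarrow{f'}D$ and $\delta'\in\mathbb{E}(F,B)$ by $B\xrightarrow{g}C\xrightarrow{g'}F$, there are an object $E$, morphisms $d:D\to E$, $e:E\to F$, $h=gf:A\to C$, $h':C\to E$ with $h'g=df'$, $eh'=g'$, and $\delta''\in\mathbb{E}(E,A)$ realized by $A\xrightarrow{h}C\xrightarrow{h'}E$ such that $D\xrightarrow{d}E\xrightarrow{e}F$ realizes $f'_*\delta'$, $d^*\delta''=\delta$, and $f_*\delta''=e^*\delta'$;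 (ET4)$^{\rm op}$ the dual of (ET4). A sequence $A\xrightarrow{x}B\xrightarrow{y}C$ realizing some $\delta\in\mathbb{E}(C,A)$ is called a conflation (and, together with $\delta$, an $\mathbb{E}$-triangle); $x$ is called an inflation, $y$ a deflation, $\mathrm{Cone}(x):=C$ and $\mathrm{CoCone}(y):=A$ (well defined up to isomorphism; membership of objects in classes is understood up to isomorphism). **Weakly idempotent complete** means that every split monomorphism has a cokernel; for an extriangulated category this is equivalent to Condition (WIC): for composable $f,g$, if $gf$ is an inflation then so is $f$, and if $gf$ is a deflation then so is $g$. **Weak factorization systems.** For $l:A\to B$ and $r:C\to D$, write $l\,\Box\,r$ if for all $f:A\to C$, $g:B\to D$ with $rf=gl$ there is $t:B\to C$ with $tl=f$, $rt=g$. For a class $\mathcal{M}$ of morphisms, $\mathcal{M}^{\Box}$ is the class of $r$ with $l\,\Box\,r$ for all $l\in\mathcal{M}$, and ${}^{\Box}\mathcal{M}$ is the class of $l$ with $l\,\Box\,r$ for all $r\in\mathcal{M}$. A pair $(\mathcal{L},\mathcal{R})$ of classes of morphisms is a weak factorization system if $\mathcal{L}^{\Box}=\mathcal{R}$, ${}^{\Box}\mathcal{R}=\mathcal{L}$, and every morphism $h$ factors as $h=gf$ with $f\in\mathcal{L}$, $g\in\mathcal{R}$. It is admissible if for every morphism $f$: (1) $f\in\mathcal{L}$ iff $f$ is an inflation and $0\to\mathrm{Cone}(f)$ belongs to $\mathcal{L}$; (2) $f\in\mathcal{R}$ iff $f$ is a deflation and $\mathrm{CoCone}(f)\to0$ belongs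 to $\mathcal{R}$. **Notation.** $\mathrm{Infl}\,\mathcal{X}$ is the class of inflations $f$ with $\mathrm{Cone}(f)\in\mathcal{X}$, and $\mathrm{Defl}\,\mathcal{X}$ the class of deflations $f$ with $\mathrm{CoCone}(f)\in\mathcal{X}$. **Cancellation.** A class $\mathcal{L}$ of morphisms satisfies the left cancellation property if $\beta\alpha\in\mathcal{L}$ and $\beta\in\mathcal{L}$ imply $\alpha\in\mathcal{L}$. A class $\mathcal{R}$ satisfies the right cancellation property if $\beta\alpha\in\mathcal{R}$ and $\alpha\in\mathcal{R}$ imply $\beta\in\mathcal{R}$. **Cotorsion pairs.** A cotorsion pair on $\mathcal{C}$ is a pair $(\mathcal{U},\mathcal{V})$ of full additive subcategories closed under isomorphisms and direct summands such that $\mathbb{E}(U,V)=0$ for all $U\in\mathcal{U}$, $V\in\mathcal{V}$, and for every $C\in\mathcal{C}$ there are conflations $V^C\to U^C\to C$ and $C\to V_C\to U_C$ with $U^C,U_C\in\mathcal{U}$ and $V^C,V_C\in\mathcal{V}$. It is hereditary if $\mathcal{U}$ is closed under cocones of deflations (for every conflation $A\to B\to C$ with $B,C\in\mathcal{U}$ one has $A\in\mathcal{U}$) and $\mathcal{V}$ is closed under cones of inflations (for every conflation $A\to B\to C$ with $A,B\in\mathcal{V}$ one has $C\in\mathcal{V}$). *)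

theory Defs
  imports "HOL-Algebra.Group"
begin

section \<open>Additive categories\<close>

text \<open>\<open>Cmp g f\<close> is the composite \<open>g\<close> after \<open>f\<close>. Every arrow has one domain and one codomain, so
  classes of morphisms are plain sets of arrows. \<open>Add\<close> is meaningful only on parallel arrows.\<close>

record ('o, 'm) precat =
  Obj :: "'o set"
  Arr :: "'m set"
  Dom :: "'m \<Rightarrow> 'o"
  Cod :: "'m \<Rightarrow> 'o"
  Ide :: "'o \<Rightarrow> 'm"
  Cmp :: "'m \<Rightarrow> 'm \<Rightarrow> 'm"  (infixl "\<cdot>\<index>" 70)
  Add :: "'m \<Rightarrow> 'm \<Rightarrow> 'm"  (infixl "\<boxplus>\<index>" 65)
  Zer :: "'o \<Rightarrow> 'o \<Rightarrow> 'm"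

definition homs :: "('o, 'm, 'z) precat_scheme \<Rightarrow> 'o \<Rightarrow> 'o \<Rightarrow> 'm set" where
  "homs X A B = {f \<in> Arr X. Dom X f = A \<and> Cod X f = B}"

definition hom_group :: "('o, 'm, 'z) precat_scheme \<Rightarrow> 'o \<Rightarrow> 'o \<Rightarrow> 'm monoid" where
  "hom_group X A B = \<lparr>carrier = homs X A B, monoid.mult = Add X, one = Zer X A B\<rparr>"

definition is_iso :: "('o, 'm, 'z) precat_scheme \<Rightarrow> 'm \<Rightarrow> bool" where
  "is_iso X f \<longleftrightarrow> f \<in> Arr X \<and>
     (\<exists>g \<in> homs X (Cod X f) (Dom X f).
        g \<cdot>\<^bsub>X\<^esub> f = Ide X (Dom X f) \<and> f \<cdot>\<^bsub>X\<^esub> g = Ide X (Cod X f))"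

definition isomorphic :: "('o, 'm, 'z) precat_scheme \<Rightarrow> 'o \<Rightarrow> 'o \<Rightarrow> bool" where
  "isomorphic X A B \<longleftrightarrow> (\<exists>f \<in> homs X A B. is_iso X f)"

definition zero_object :: "('o, 'm, 'z) precat_scheme \<Rightarrow> 'o \<Rightarrow> bool" where
  "zero_object X Z \<longleftrightarrow> Z \<in> Obj X \<and>
     (\<forall>A \<in> Obj X. (\<exists>!f. f \<in> homs X Z A) \<and> (\<exists>!f. f \<in> homs X A Z))"

text \<open>\<open>P\<close> is the direct sum of \<open>A\<close> and \<open>B\<close>, with injections \<open>i\<close>, \<open>j\<close> and projections \<open>p\<close>, \<open>q\<close>.\<close>

definition biproduct ::
  "('o, 'm, 'z) precat_scheme \<Rightarrow> 'o \<Rightarrow> 'o \<Rightarrow> 'o \<Rightarrow> 'm \<Rightarrow> 'm \<Rightarrow> 'm \<Rightarrow> 'm \<Rightarrow> bool" where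
  "biproduct X A B P i j p q \<longleftrightarrow>
     A \<in> Obj X \<and> B \<in> Obj X \<and> P \<in> Obj X \<and>
     i \<in> homs X A P \<and> j \<in> homs X B P \<and> p \<in> homs X P A \<and> q \<in> homs X P B \<and>
     p \<cdot>\<^bsub>X\<^esub> i = Ide X A \<and> q \<cdot>\<^bsub>X\<^esub> j = Ide X B \<and>
     q \<cdot>\<^bsub>X\<^esub> i = Zer X A B \<and> p \<cdot>\<^bsub>X\<^esub> j = Zer X B A \<and>
     (i \<cdot>\<^bsub>X\<^esub> p) \<boxplus>\<^bsub>X\<^esub> (j \<cdot>\<^bsub>X\<^esub> q) = Ide X P"

locale category =
  fixes X :: "('o, 'm, 'z) precat_scheme" (structure)
  assumes Dom_Obj: "f \<in> Arr X \<Longrightarrow> Dom X f \<in> Obj X"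
    and Cod_Obj: "f \<in> Arr X \<Longrightarrow> Cod X f \<in> Obj X"
    and Ide_hom: "A \<in> Obj X \<Longrightarrow> Ide X A \<in> homs X A A"
    and Cmp_hom: "\<lbrakk>f \<in> homs X A B; g \<in> homs X B C\<rbrakk> \<Longrightarrow> g \<cdot> f \<in> homs X A C"
    and Cmp_Ide: "f \<in> homs X A B \<Longrightarrow> f \<cdot> Ide X A = f"
    and Ide_Cmp: "f \<in> homs X A B \<Longrightarrow> Ide X B \<cdot> f = f"
    and Cmp_assoc: "\<lbrakk>f \<in> homs X A B; g \<in> homs X B C; h \<in> homs X C D\<rbrakk> \<Longrightarrow>
      h \<cdot> (g \<cdot> f) = (h \<cdot> g) \<cdot> f"

locale additive_category = category +
  assumes hom_comm_group: "\<lbrakk>A \<in> Obj X; B \<in> Obj X\<rbrakk> \<Longrightarrow> comm_group (hom_group X A B)"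
    and Cmp_Add: "\<lbrakk>f \<in> homs X A B; f' \<in> homs X A B; g \<in> homs X B C\<rbrakk> \<Longrightarrow>
      g \<cdot> (f \<boxplus> f') = (g \<cdot> f) \<boxplus> (g \<cdot> f')"
    and Add_Cmp: "\<lbrakk>f \<in> homs X A B; g \<in> homs X B C; g' \<in> homs X B C\<rbrakk> \<Longrightarrow>
      (g \<boxplus> g') \<cdot> f = (g \<cdot> f) \<boxplus> (g' \<cdot> f)"
    and ex_zero_object: "\<exists>Z. zero_object X Z"
    and ex_biproduct: "\<lbrakk>A \<in> Obj X; B \<in> Obj X\<rbrakk> \<Longrightarrow> \<exists>P i j p q. biproduct X A B P i j p q"

definition is_cokernel :: "('o, 'm, 'z) precat_scheme \<Rightarrow> 'm \<Rightarrow> 'm \<Rightarrow> bool" where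
  "is_cokernel X f k \<longleftrightarrow>
     f \<in> Arr X \<and> k \<in> Arr X \<and> Dom X k = Cod X f \<and>
     k \<cdot>\<^bsub>X\<^esub> f = Zer X (Dom X f) (Cod X k) \<and>
     (\<forall>T \<in> Obj X. \<forall>t \<in> homs X (Cod X f) T. t \<cdot>\<^bsub>X\<^esub> f = Zer X (Dom X f) T \<longrightarrow>
        (\<exists>!u. u \<in> homs X (Cod X k) T \<and> u \<cdot>\<^bsub>X\<^esub> k = t))"

definition split_mono :: "('o, 'm, 'z) precat_scheme \<Rightarrow> 'm \<Rightarrow> bool" where
  "split_mono X f \<longleftrightarrow> f \<in> Arr X \<and>
     (\<exists>r \<in> homs X (Cod X f) (Dom X f). r \<cdot>\<^bsub>X\<^esub> f = Ide X (Dom X f))"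

definition weakly_idempotent_complete :: "('o, 'm, 'z) precat_scheme \<Rightarrow> bool" where
  "weakly_idempotent_complete X \<longleftrightarrow> (\<forall>f. split_mono X f \<longrightarrow> (\<exists>k. is_cokernel X f k))"

section \<open>Extriangulated categories\<close>

text \<open>\<open>Ext C A\<close> is the group of extensions, written multiplicatively as in \<open>comm_group\<close>: its
  \<open>\<otimes>\<close> is the sum and its \<open>\<one>\<close> the zero extension. \<open>ExtMap c a\<close> is the value of the bifunctor on
  the pair \<open>(c, a)\<close>, contravariant in \<open>c\<close>. \<open>Rlz C A \<delta>\<close> is the equivalence class of sequences
  assigned to \<open>\<delta>\<close>; since groups at different objects may share elements, it depends on \<open>C\<close> and \<open>A\<close>.\<close>

record ('o, 'm, 'e) extri = "('o, 'm) precat" +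
  Ext :: "'o \<Rightarrow> 'o \<Rightarrow> 'e monoid"
  ExtMap :: "'m \<Rightarrow> 'm \<Rightarrow> 'e \<Rightarrow> 'e"
  Rlz :: "'o \<Rightarrow> 'o \<Rightarrow> 'e \<Rightarrow> ('m \<times> 'm) set"

text \<open>For \<open>\<delta>\<close> in \<open>Ext C A\<close>: \<open>push X C a \<delta>\<close> is \<open>a\<^sub>*\<delta>\<close> and \<open>pull X A c \<delta>\<close> is \<open>c\<^sup>*\<delta>\<close>.\<close>

definition push :: "('o, 'm, 'e, 'z) extri_scheme \<Rightarrow> 'o \<Rightarrow> 'm \<Rightarrow> 'e \<Rightarrow> 'e" where
  "push X C a \<delta> = ExtMap X (Ide X C) a \<delta>"

definition pull :: "('o, 'm, 'e, 'z) extri_scheme \<Rightarrow> 'o \<Rightarrow> 'm \<Rightarrow> 'e \<Rightarrow> 'e" where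
  "pull X A c \<delta> = ExtMap X c (Ide X A) \<delta>"

definition ext_morphism ::
  "('o, 'm, 'e, 'z) extri_scheme \<Rightarrow> 'o \<Rightarrow> 'o \<Rightarrow> 'e \<Rightarrow> 'o \<Rightarrow> 'o \<Rightarrow> 'e \<Rightarrow> 'm \<Rightarrow> 'm \<Rightarrow> bool" where
  "ext_morphism X C A \<delta> C' A' \<delta>' a c \<longleftrightarrow>
     \<delta> \<in> carrier (Ext X C A) \<and> \<delta>' \<in> carrier (Ext X C' A') \<and>
     a \<in> homs X A A' \<and> c \<in> homs X C C' \<and>
     push X C a \<delta> = pull X A' c \<delta>'"

definition is_seq :: "('o, 'm, 'z) precat_scheme \<Rightarrow> 'o \<Rightarrow> 'o \<Rightarrow> 'm \<Rightarrow> 'm \<Rightarrow> bool" where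
  "is_seq X A C x y \<longleftrightarrow>
     x \<in> Arr X \<and> y \<in> Arr X \<and> Dom X x = A \<and> Cod X x = Dom X y \<and> Cod X y = C"

definition seq_equiv ::
  "('o, 'm, 'z) precat_scheme \<Rightarrow> 'm \<Rightarrow> 'm \<Rightarrow> 'm \<Rightarrow> 'm \<Rightarrow> bool" where
  "seq_equiv X x y x' y' \<longleftrightarrow>
     (\<exists>b \<in> homs X (Cod X x) (Cod X x'). is_iso X b \<and> b \<cdot>\<^bsub>X\<^esub> x = x' \<and> y' \<cdot>\<^bsub>X\<^esub> b = y)"

definition realizes :: "('o, 'm, 'e, 'z) extri_scheme \<Rightarrow> 'e \<Rightarrow> 'm \<Rightarrow> 'm \<Rightarrow> bool" where
  "realizes X \<delta> x y \<longleftrightarrow>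
     x \<in> Arr X \<and> y \<in> Arr X \<and> Cod X x = Dom X y \<and>
     \<delta> \<in> carrier (Ext X (Cod X y) (Dom X x)) \<and>
     (x, y) \<in> Rlz X (Cod X y) (Dom X x) \<delta>"

text \<open>The direct sum \<open>f \<oplus> f'\<close> of two arrows, given the projections \<open>p\<close>, \<open>q\<close> of the source and the
  injections \<open>i\<close>, \<open>j\<close> of the target. Likewise, \<open>\<delta> \<oplus> \<delta>'\<close> is the extension with matrix
  \<open>diag(\<delta>, \<delta>')\<close> under the decomposition of the extension group of two direct sums,
  written as a sum using biadditivity.\<close>

definition arr_sum ::
  "('o, 'm, 'z) precat_scheme \<Rightarrow> 'm \<Rightarrow> 'm \<Rightarrow> 'm \<Rightarrow> 'm \<Rightarrow> 'm \<Rightarrow> 'm \<Rightarrow> 'm" where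
  "arr_sum X p q i j f f' = (i \<cdot>\<^bsub>X\<^esub> f \<cdot>\<^bsub>X\<^esub> p) \<boxplus>\<^bsub>X\<^esub> (j \<cdot>\<^bsub>X\<^esub> f' \<cdot>\<^bsub>X\<^esub> q)"

definition ext_sum ::
  "('o, 'm, 'e, 'z) extri_scheme \<Rightarrow> 'o \<Rightarrow> 'o \<Rightarrow> 'm \<Rightarrow> 'm \<Rightarrow> 'm \<Rightarrow> 'm \<Rightarrow> 'e \<Rightarrow> 'e \<Rightarrow> 'e" where
  "ext_sum X CC AA p q i j \<delta> \<delta>' =
     ExtMap X p i \<delta> \<otimes>\<^bsub>Ext X CC AA\<^esub> ExtMap X q j \<delta>'"

locale additive_bifunctor = additive_category X
  for X :: "('o, 'm, 'e, 'z) extri_scheme" (structure) +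
  assumes Ext_comm_group: "\<lbrakk>C \<in> Obj X; A \<in> Obj X\<rbrakk> \<Longrightarrow> comm_group (Ext X C A)"
    and ExtMap_hom: "\<lbrakk>c \<in> homs X C' C; a \<in> homs X A A'\<rbrakk> \<Longrightarrow>
      ExtMap X c a \<in> hom (Ext X C A) (Ext X C' A')"
    and ExtMap_Ide: "\<lbrakk>C \<in> Obj X; A \<in> Obj X; \<delta> \<in> carrier (Ext X C A)\<rbrakk> \<Longrightarrow>
      ExtMap X (Ide X C) (Ide X A) \<delta> = \<delta>"
    and ExtMap_Cmp: "\<lbrakk>c \<in> homs X C' C; c' \<in> homs X C'' C'; a \<in> homs X A A'; a' \<in> homs X A' A'';
      \<delta> \<in> carrier (Ext X C A)\<rbrakk> \<Longrightarrow>
      ExtMap X (c \<cdot> c') (a' \<cdot> a) \<delta> = ExtMap X c' a' (ExtMap X c a \<delta>)"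
    and ExtMap_Add_left: "\<lbrakk>c \<in> homs X C' C; c' \<in> homs X C' C; a \<in> homs X A A';
      \<delta> \<in> carrier (Ext X C A)\<rbrakk> \<Longrightarrow>
      ExtMap X (c \<boxplus> c') a \<delta> = ExtMap X c a \<delta> \<otimes>\<^bsub>Ext X C' A'\<^esub> ExtMap X c' a \<delta>"
    and ExtMap_Add_right: "\<lbrakk>c \<in> homs X C' C; a \<in> homs X A A'; a' \<in> homs X A A';
      \<delta> \<in> carrier (Ext X C A)\<rbrakk> \<Longrightarrow>
      ExtMap X c (a \<boxplus> a') \<delta> = ExtMap X c a \<delta> \<otimes>\<^bsub>Ext X C' A'\<^esub> ExtMap X c a' \<delta>"

locale additive_realization = additive_bifunctor +
  assumes Rlz_class: "\<lbrakk>C \<in> Obj X; A \<in> Obj X; \<delta> \<in> carrier (Ext X C A)\<rbrakk> \<Longrightarrow>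
      \<exists>x y. is_seq X A C x y \<and>
        Rlz X C A \<delta> = {(x', y'). is_seq X A C x' y' \<and> seq_equiv X x y x' y'}"
    and Rlz_morphism: "\<lbrakk>realizes X \<delta> x y; realizes X \<delta>' x' y';
      ext_morphism X (Cod X y) (Dom X x) \<delta> (Cod X y') (Dom X x') \<delta>' a c\<rbrakk> \<Longrightarrow>
      \<exists>b \<in> homs X (Cod X x) (Cod X x'). b \<cdot> x = x' \<cdot> a \<and> y' \<cdot> b = c \<cdot> y"
    and Rlz_zero: "biproduct X A C P i j p q \<Longrightarrow> realizes X \<one>\<^bsub>Ext X C A\<^esub> i q"
    and Rlz_sum: "\<lbrakk>realizes X \<delta> x y; realizes X \<delta>' x' y';
      biproduct X (Dom X x) (Dom X x') AA iA jA pA qA;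
      biproduct X (Cod X x) (Cod X x') BB iB jB pB qB;
      biproduct X (Cod X y) (Cod X y') CC iC jC pC qC\<rbrakk> \<Longrightarrow>
      realizes X (ext_sum X CC AA pC qC iA jA \<delta> \<delta>')
        (arr_sum X pA qA iB jB x x') (arr_sum X pB qB iC jC y y')"

locale extriangulated_category = additive_realization +
  assumes ET3: "\<lbrakk>realizes X \<delta> x y; realizes X \<delta>' x' y';
      a \<in> homs X (Dom X x) (Dom X x'); b \<in> homs X (Cod X x) (Cod X x'); b \<cdot> x = x' \<cdot> a\<rbrakk> \<Longrightarrow>
      \<exists>c \<in> homs X (Cod X y) (Cod X y'). c \<cdot> y = y' \<cdot> b \<and>
        push X (Cod X y) a \<delta> = pull X (Dom X x') c \<delta>'"
    and ET3_op: "\<lbrakk>realizes X \<delta> x y; realizes X \<delta>' x' y';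
      b \<in> homs X (Cod X x) (Cod X x'); c \<in> homs X (Cod X y) (Cod X y'); c \<cdot> y = y' \<cdot> b\<rbrakk> \<Longrightarrow>
      \<exists>a \<in> homs X (Dom X x) (Dom X x'). b \<cdot> x = x' \<cdot> a \<and>
        push X (Cod X y) a \<delta> = pull X (Dom X x') c \<delta>'"
    and ET4: "\<lbrakk>f \<in> homs X A B; f' \<in> homs X B D; realizes X \<delta> f f';
      g \<in> homs X B C; g' \<in> homs X C F; realizes X \<delta>' g g'\<rbrakk> \<Longrightarrow>
      \<exists>E \<in> Obj X. \<exists>d \<in> homs X D E. \<exists>e \<in> homs X E F. \<exists>h' \<in> homs X C E.
        \<exists>\<delta>'' \<in> carrier (Ext X E A).
        h' \<cdot> g = d \<cdot> f' \<and> e \<cdot> h' = g' \<and>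
        realizes X \<delta>'' (g \<cdot> f) h' \<and> realizes X (push X F f' \<delta>') d e \<and>
        pull X A d \<delta>'' = \<delta> \<and> push X E f \<delta>'' = pull X B e \<delta>'"
    and ET4_op: "\<lbrakk>f' \<in> homs X D B; f \<in> homs X B A; realizes X \<delta> f' f;
      g' \<in> homs X F C; g \<in> homs X C B; realizes X \<delta>' g' g\<rbrakk> \<Longrightarrow>
      \<exists>E \<in> Obj X. \<exists>d \<in> homs X E D. \<exists>e \<in> homs X F E. \<exists>h' \<in> homs X E C.
        \<exists>\<delta>'' \<in> carrier (Ext X A E).
        g \<cdot> h' = f' \<cdot> d \<and> h' \<cdot> e = g' \<and>
        realizes X \<delta>'' h' (f \<cdot> g) \<and> realizes X (pull X F f' \<delta>') e d \<and>
        push X A d \<delta>'' = \<delta> \<and> pull X E f \<delta>'' = push X B e \<delta>'"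

definition conflation :: "('o, 'm, 'e, 'z) extri_scheme \<Rightarrow> 'm \<Rightarrow> 'm \<Rightarrow> bool" where
  "conflation X x y \<longleftrightarrow> (\<exists>\<delta>. realizes X \<delta> x y)"

definition inflation :: "('o, 'm, 'e, 'z) extri_scheme \<Rightarrow> 'm \<Rightarrow> bool" where
  "inflation X x \<longleftrightarrow> (\<exists>y. conflation X x y)"

definition deflation :: "('o, 'm, 'e, 'z) extri_scheme \<Rightarrow> 'm \<Rightarrow> bool" where
  "deflation X y \<longleftrightarrow> (\<exists>x. conflation X x y)"

text \<open>Cones and cocones are determined up to isomorphism only, so they are relations; for a class
  of objects closed under isomorphisms it does not matter which cone is tested.\<close>

definition is_Cone :: "('o, 'm, 'e, 'z) extri_scheme \<Rightarrow> 'm \<Rightarrow> 'o \<Rightarrow> bool" where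
  "is_Cone X x C \<longleftrightarrow> (\<exists>y. conflation X x y \<and> Cod X y = C)"

definition is_CoCone :: "('o, 'm, 'e, 'z) extri_scheme \<Rightarrow> 'm \<Rightarrow> 'o \<Rightarrow> bool" where
  "is_CoCone X y A \<longleftrightarrow> (\<exists>x. conflation X x y \<and> Dom X x = A)"

definition Infl :: "('o, 'm, 'e, 'z) extri_scheme \<Rightarrow> 'o set \<Rightarrow> 'm set" where
  "Infl X U = {f. inflation X f \<and> (\<exists>C \<in> U. is_Cone X f C)}"

definition Defl :: "('o, 'm, 'e, 'z) extri_scheme \<Rightarrow> 'o set \<Rightarrow> 'm set" where
  "Defl X V = {f. deflation X f \<and> (\<exists>A \<in> V. is_CoCone X f A)}"

section \<open>Weak factorization systems\<close>

definition lifts :: "('o, 'm, 'z) precat_scheme \<Rightarrow> 'm \<Rightarrow> 'm \<Rightarrow> bool" where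
  "lifts X l r \<longleftrightarrow>
     (\<forall>f \<in> homs X (Dom X l) (Dom X r). \<forall>g \<in> homs X (Cod X l) (Cod X r).
        r \<cdot>\<^bsub>X\<^esub> f = g \<cdot>\<^bsub>X\<^esub> l \<longrightarrow>
        (\<exists>t \<in> homs X (Cod X l) (Dom X r). t \<cdot>\<^bsub>X\<^esub> l = f \<and> r \<cdot>\<^bsub>X\<^esub> t = g))"

definition rlp :: "('o, 'm, 'z) precat_scheme \<Rightarrow> 'm set \<Rightarrow> 'm set" where
  "rlp X M = {r \<in> Arr X. \<forall>l \<in> M. lifts X l r}"

definition llp :: "('o, 'm, 'z) precat_scheme \<Rightarrow> 'm set \<Rightarrow> 'm set" where
  "llp X M = {l \<in> Arr X. \<forall>r \<in> M. lifts X l r}"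

definition weak_factorization_system ::
  "('o, 'm, 'z) precat_scheme \<Rightarrow> 'm set \<Rightarrow> 'm set \<Rightarrow> bool" where
  "weak_factorization_system X L R \<longleftrightarrow>
     L \<subseteq> Arr X \<and> R \<subseteq> Arr X \<and> rlp X L = R \<and> llp X R = L \<and>
     (\<forall>h \<in> Arr X. \<exists>f \<in> L. \<exists>g \<in> R. Cod X f = Dom X g \<and> h = g \<cdot>\<^bsub>X\<^esub> f)"

text \<open>The classes of a weak factorization system are closed under composition with isomorphisms,
  so the choice of the zero object and of the (co)cone is immaterial.\<close>

definition admissible_wfs ::
  "('o, 'm, 'e, 'z) extri_scheme \<Rightarrow> 'm set \<Rightarrow> 'm set \<Rightarrow> bool" where
  "admissible_wfs X L R \<longleftrightarrow> weak_factorization_system X L R \<and>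
     (\<forall>f \<in> Arr X. f \<in> L \<longleftrightarrow>
        inflation X f \<and> (\<exists>C Z. is_Cone X f C \<and> zero_object X Z \<and> Zer X Z C \<in> L)) \<and>
     (\<forall>f \<in> Arr X. f \<in> R \<longleftrightarrow>
        deflation X f \<and> (\<exists>A Z. is_CoCone X f A \<and> zero_object X Z \<and> Zer X A Z \<in> R))"

definition left_cancellation :: "('o, 'm, 'z) precat_scheme \<Rightarrow> 'm set \<Rightarrow> bool" where
  "left_cancellation X L \<longleftrightarrow>
     (\<forall>\<alpha> \<in> Arr X. \<forall>\<beta> \<in> Arr X. Cod X \<alpha> = Dom X \<beta> \<longrightarrow>
        \<beta> \<cdot>\<^bsub>X\<^esub> \<alpha> \<in> L \<longrightarrow> \<beta> \<in> L \<longrightarrow> \<alpha> \<in> L)"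

definition right_cancellation :: "('o, 'm, 'z) precat_scheme \<Rightarrow> 'm set \<Rightarrow> bool" where
  "right_cancellation X R \<longleftrightarrow>
     (\<forall>\<alpha> \<in> Arr X. \<forall>\<beta> \<in> Arr X. Cod X \<alpha> = Dom X \<beta> \<longrightarrow>
        \<beta> \<cdot>\<^bsub>X\<^esub> \<alpha> \<in> R \<longrightarrow> \<alpha> \<in> R \<longrightarrow> \<beta> \<in> R)"

section \<open>Cotorsion pairs\<close>

definition iso_closed :: "('o, 'm, 'z) precat_scheme \<Rightarrow> 'o set \<Rightarrow> bool" where
  "iso_closed X U \<longleftrightarrow> (\<forall>A \<in> U. \<forall>B \<in> Obj X. isomorphic X A B \<longrightarrow> B \<in> U)"

text \<open>Membership of objects in classes is always meant up to isomorphism, so a class of objects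
  is a set of objects that is closed under isomorphisms.\<close>

definition object_class :: "('o, 'm, 'z) precat_scheme \<Rightarrow> 'o set \<Rightarrow> bool" where
  "object_class X U \<longleftrightarrow> U \<subseteq> Obj X \<and> iso_closed X U"

text \<open>A full subcategory is given by its objects; it is additive iff it contains a zero object
  and a direct sum of any two of its objects.\<close>

definition additive_subcategory :: "('o, 'm, 'z) precat_scheme \<Rightarrow> 'o set \<Rightarrow> bool" where
  "additive_subcategory X U \<longleftrightarrow> U \<subseteq> Obj X \<and> (\<exists>Z \<in> U. zero_object X Z) \<and>
     (\<forall>A \<in> U. \<forall>B \<in> U. \<exists>P \<in> U. \<exists>i j p q. biproduct X A B P i j p q)"

definition summand_closed :: "('o, 'm, 'z) precat_scheme \<Rightarrow> 'o set \<Rightarrow> bool" where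
  "summand_closed X U \<longleftrightarrow>
     (\<forall>A B P i j p q. biproduct X A B P i j p q \<longrightarrow> P \<in> U \<longrightarrow> A \<in> U \<and> B \<in> U)"

definition cotorsion_pair ::
  "('o, 'm, 'e, 'z) extri_scheme \<Rightarrow> 'o set \<Rightarrow> 'o set \<Rightarrow> bool" where
  "cotorsion_pair X U V \<longleftrightarrow>
     additive_subcategory X U \<and> iso_closed X U \<and> summand_closed X U \<and>
     additive_subcategory X V \<and> iso_closed X V \<and> summand_closed X V \<and>
     (\<forall>A \<in> U. \<forall>B \<in> V. carrier (Ext X A B) = {\<one>\<^bsub>Ext X A B\<^esub>}) \<and>
     (\<forall>C \<in> Obj X. \<exists>x y. conflation X x y \<and> Dom X x \<in> V \<and> Cod X x \<in> U \<and> Cod X y = C) \<and>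
     (\<forall>C \<in> Obj X. \<exists>x y. conflation X x y \<and> Dom X x = C \<and> Cod X x \<in> V \<and> Cod X y \<in> U)"

definition hereditary_cotorsion_pair ::
  "('o, 'm, 'e, 'z) extri_scheme \<Rightarrow> 'o set \<Rightarrow> 'o set \<Rightarrow> bool" where
  "hereditary_cotorsion_pair X U V \<longleftrightarrow> cotorsion_pair X U V \<and>
     (\<forall>x y. conflation X x y \<longrightarrow> Cod X x \<in> U \<longrightarrow> Cod X y \<in> U \<longrightarrow> Dom X x \<in> U) \<and>
     (\<forall>x y. conflation X x y \<longrightarrow> Dom X x \<in> V \<longrightarrow> Cod X x \<in> V \<longrightarrow> Cod X y \<in> V)"

end

theory Submission
  imports Defs
begin

text \<open>The two classes of a weak factorization system determine each other by lifting, and the two classes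
  of a cotorsion pair determine each other by the vanishing of \<open>E\<close>. The bridge is that lifting problems
  between an inflation with cone \<open>A\<close> and a deflation with cocone \<open>B\<close> are obstructed by \<open>E(A, B)\<close>
  (\<open>lifts_if_Ext_vanish\<close>), while conversely lifting \<open>0 \<rightarrow> A\<close> against the deflation of a triangle
  \<open>B \<rightarrow> M \<rightarrow> A\<close> splits that triangle (\<open>wfs_Ext_vanish\<close>).

  From a cotorsion pair to a factorization of \<open>h : A \<rightarrow> B\<close>: a deflation \<open>u : U\<^sub>1 \<rightarrow> B\<close> with cocone in \<open>V\<close> makes
  \<open>(h, u) : A \<oplus> U\<^sub>1 \<rightarrow> B\<close> a deflation, whose cocone \<open>K\<close> embeds into an object of \<open>V\<close> with cone in \<open>U\<close>.
  Pushing out along that inflation (\<open>conflation_pushout\<close>) replaces the cocone \<open>K\<close> by an object of \<open>V\<close> at the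
  cost of an inflation with cone in \<open>U\<close>. That the classes are exactly the lifting complements
  of each other is the retract argument (\<open>cotorsion_llp_subset\<close>). For composable inflations \<open>\<alpha>\<close> and \<open>\<beta>\<close>, the
  cones of \<open>\<alpha>\<close>, \<open>\<beta> \<alpha>\<close> and \<open>\<beta>\<close> form a conflation by (ET4), so heredity of \<open>U\<close> yields left cancellation. Weak
  idempotent completeness enters in the retract argument and in cancellation, through Condition (WIC)
  (\<open>inflation_cancel\<close>).

  Conversely, \<open>0 \<rightarrow> C\<close> is an inflation with cone \<open>C\<close>, so factoring \<open>0 \<rightarrow> C\<close> gives the approximations of a
  cotorsion pair, and cancelling an inflation \<open>x : A \<rightarrow> B\<close> with cone in \<open>U\<close> from \<open>0 \<rightarrow> A \<rightarrow> B\<close> gives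
  heredity of \<open>U\<close>. Heredity of \<open>V\<close> follows from that of \<open>U\<close> (\<open>cotorsion_hereditary\<close>).

  Only the equivalence with left cancellation is proved by hand. The axioms are self-dual, so the opposite
  category is again extriangulated (\<open>extriangulated_category_Op\<close>); applied to the pair \<open>(V, U)\<close> there, the same
  equivalence is the one with right cancellation. Duality also supplies half of the lemmas.\<close>

section \<open>Additive categories\<close>

lemma homs_iff: "f \<in> homs X A B \<longleftrightarrow> f \<in> Arr X \<and> Dom X f = A \<and> Cod X f = B"
  by (simp add: homs_def)

context category
begin

lemma hom_obj: "f \<in> homs X A B \<Longrightarrow> A \<in> Obj X" "f \<in> homs X A B \<Longrightarrow> B \<in> Obj X"
  using Dom_Obj Cod_Obj by (auto simp: homs_iff)

lemma iso_obtain: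
  assumes "is_iso X f" "f \<in> homs X A B"
  obtains g where "g \<in> homs X B A" "g \<cdot> f = Ide X A" "f \<cdot> g = Ide X B"
  using assms unfolding is_iso_def by (auto simp: homs_iff)

lemma isoI: "f \<in> homs X A B \<Longrightarrow> g \<in> homs X B A \<Longrightarrow> g \<cdot> f = Ide X A \<Longrightarrow> f \<cdot> g = Ide X B
    \<Longrightarrow> is_iso X f"
  unfolding is_iso_def by (auto simp: homs_iff)

lemma iso_Cmp:
  assumes f: "is_iso X f" "f \<in> homs X A B" and g: "is_iso X g" "g \<in> homs X B C"
  shows "is_iso X (g \<cdot> f)"
proof -
  obtain f' where f': "f' \<in> homs X B A" "f' \<cdot> f = Ide X A" "f \<cdot> f' = Ide X B"
    using iso_obtain f by blast
  obtain g' where g': "g' \<in> homs X C B" "g' \<cdot> g = Ide X B" "g \<cdot> g' = Ide X C"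
    using iso_obtain g by blast
  have "(f' \<cdot> g') \<cdot> (g \<cdot> f) = f' \<cdot> ((g' \<cdot> g) \<cdot> f)"
    using Cmp_assoc[OF Cmp_hom[OF f(2) g(2)] g'(1) f'(1)] Cmp_assoc[OF f(2) g(2) g'(1)] by simp
  moreover have "(g \<cdot> f) \<cdot> (f' \<cdot> g') = g \<cdot> ((f \<cdot> f') \<cdot> g')"
    using Cmp_assoc[OF Cmp_hom[OF g'(1) f'(1)] f(2) g(2)] Cmp_assoc[OF g'(1) f'(1) f(2)] by simp
  ultimately show ?thesis
    using f' g' f g by (intro isoI[of _ A C "f' \<cdot> g'"]) (auto intro: Cmp_hom simp: Ide_Cmp)
qed

lemma iso_closedD:
  "iso_closed X U \<Longrightarrow> A \<in> U \<Longrightarrow> f \<in> homs X A B \<Longrightarrow> is_iso X f \<Longrightarrow> B \<in> U"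
  unfolding iso_closed_def isomorphic_def using hom_obj by blast

lemma zero_object_unique:
  "zero_object X Z \<Longrightarrow> f \<in> homs X Z A \<Longrightarrow> g \<in> homs X Z A \<Longrightarrow> f = g"
  "zero_object X Z \<Longrightarrow> f \<in> homs X A Z \<Longrightarrow> g \<in> homs X A Z \<Longrightarrow> f = g"
  unfolding zero_object_def using hom_obj by blast+

end

context additive_category
begin

definition diff :: "'b \<Rightarrow> 'b \<Rightarrow> 'b" (infixl "\<boxminus>" 65) where
  "f \<boxminus> g = f \<boxplus> (inv\<^bsub>hom_group X (Dom X f) (Cod X f)\<^esub> g)"

lemma Zer_hom:
  assumes "A \<in> Obj X" "B \<in> Obj X"
  shows "Zer X A B \<in> homs X A B"
proof -
  interpret H: comm_group "hom_group X A B" using assms by (rule hom_comm_group)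
  show ?thesis using H.one_closed by (simp add: hom_group_def)
qed

lemma Add_hom:
  assumes f: "f \<in> homs X A B" and g: "g \<in> homs X A B"
  shows "f \<boxplus> g \<in> homs X A B"
proof -
  interpret H: comm_group "hom_group X A B" using hom_obj[OF f] by (rule hom_comm_group)
  show ?thesis using H.m_closed[of f g] f g by (simp add: hom_group_def)
qed

lemma Add_Zer: "f \<in> homs X A B \<Longrightarrow> f \<boxplus> Zer X A B = f"
  and Zer_Add: "f \<in> homs X A B \<Longrightarrow> Zer X A B \<boxplus> f = f"
  and Add_commute: "f \<in> homs X A B \<Longrightarrow> g \<in> homs X A B \<Longrightarrow> f \<boxplus> g = g \<boxplus> f"
  and Add_assoc: "f \<in> homs X A B \<Longrightarrow> g \<in> homs X A B \<Longrightarrow> h \<in> homs X A B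
     \<Longrightarrow> (f \<boxplus> g) \<boxplus> h = f \<boxplus> (g \<boxplus> h)"
  and Add_right_cancel: "f \<in> homs X A B \<Longrightarrow> g \<in> homs X A B \<Longrightarrow> h \<in> homs X A B
     \<Longrightarrow> (g \<boxplus> f = h \<boxplus> f) = (g = h)"
  and diff_hom: "f \<in> homs X A B \<Longrightarrow> g \<in> homs X A B \<Longrightarrow> f \<boxminus> g \<in> homs X A B"
  and diff_Add: "f \<in> homs X A B \<Longrightarrow> g \<in> homs X A B \<Longrightarrow> (f \<boxminus> g) \<boxplus> g = f"
proof -
  assume f: "f \<in> homs X A B"
  then interpret H: comm_group "hom_group X A B"
    using hom_comm_group[of A B] hom_obj by blast
  have c: "carrier (hom_group X A B) = homs X A B" "mult (hom_group X A B) = Add X"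
    "one (hom_group X A B) = Zer X A B" by (auto simp: hom_group_def)
  note H = H.r_one H.l_one H.m_comm H.m_assoc H.right_cancel H.inv_closed H.m_closed H.l_inv
  note H = this[unfolded c]
  show "f \<boxplus> Zer X A B = f" "Zer X A B \<boxplus> f = f" using H f by auto
  assume g: "g \<in> homs X A B"
  show "f \<boxplus> g = g \<boxplus> f" using H f g by auto
  have e: "f \<boxminus> g = f \<boxplus> inv\<^bsub>hom_group X A B\<^esub> g"
    using f by (simp add: diff_def homs_iff)
  show "f \<boxminus> g \<in> homs X A B" unfolding e using H f g by auto
  show "(f \<boxminus> g) \<boxplus> g = f" unfolding e using H f g by auto
  assume h: "h \<in> homs X A B"
  show "(f \<boxplus> g) \<boxplus> h = f \<boxplus> (g \<boxplus> h)" using H f g h by auto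
  show "(g \<boxplus> f = h \<boxplus> f) = (g = h)" using H f g h by auto
qed

lemma diff_eqI:
  assumes f: "f \<in> homs X A B" and g: "g \<in> homs X A B" and h: "h \<in> homs X A B"
    and e: "h \<boxplus> g = f"
  shows "f \<boxminus> g = h"
  using Add_right_cancel[OF g diff_hom[OF f g] h] diff_Add[OF f g] e by simp

lemma Add_diff: "f \<in> homs X A B \<Longrightarrow> g \<in> homs X A B \<Longrightarrow> (f \<boxplus> g) \<boxminus> g = f"
  by (rule diff_eqI[of _ A B]) (auto intro: Add_hom)

lemma diff_self: "f \<in> homs X A B \<Longrightarrow> f \<boxminus> f = Zer X A B"
  by (rule diff_eqI[of _ A B]) (auto intro: Zer_hom simp: Zer_Add hom_obj)

lemma diff_Zer_eq: "f \<in> homs X A B \<Longrightarrow> g \<in> homs X A B \<Longrightarrow> f \<boxminus> g = Zer X A B \<Longrightarrow> f = g"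
  using diff_Add[of f A B g] Zer_Add[of g A B] by simp

lemma Add_idem_Zer: "f \<in> homs X A B \<Longrightarrow> f \<boxplus> f = f \<Longrightarrow> f = Zer X A B"
  using Add_diff[of f A B f] diff_self[of f A B] by simp

lemma Cmp_Zer:
  assumes g: "g \<in> homs X B C" and A: "A \<in> Obj X"
  shows "g \<cdot> Zer X A B = Zer X A C"
proof -
  note z = Zer_hom[OF A hom_obj(1)[OF g]]
  show ?thesis
    using Cmp_Add[OF z z g] Add_Zer[OF z] Cmp_hom[OF z g] by (intro Add_idem_Zer) auto
qed

lemma Zer_Cmp:
  assumes f: "f \<in> homs X A B" and C: "C \<in> Obj X"
  shows "Zer X B C \<cdot> f = Zer X A C"
proof -
  note z = Zer_hom[OF hom_obj(2)[OF f] C]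
  show ?thesis
    using Add_Cmp[OF f z z] Add_Zer[OF z] Cmp_hom[OF f z] by (intro Add_idem_Zer) auto
qed

lemma Cmp_diff: "f \<in> homs X A B \<Longrightarrow> g \<in> homs X A B \<Longrightarrow> h \<in> homs X B C
    \<Longrightarrow> h \<cdot> (f \<boxminus> g) = (h \<cdot> f) \<boxminus> (h \<cdot> g)"
  by (rule sym, rule diff_eqI[of _ A C])
    (auto intro: Cmp_hom diff_hom simp: Cmp_Add[symmetric, OF diff_hom] diff_Add)

lemma diff_Cmp: "h \<in> homs X A B \<Longrightarrow> f \<in> homs X B C \<Longrightarrow> g \<in> homs X B C
    \<Longrightarrow> (f \<boxminus> g) \<cdot> h = (f \<cdot> h) \<boxminus> (g \<cdot> h)"
  by (rule sym, rule diff_eqI[of _ A C])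
    (auto intro: Cmp_hom diff_hom simp: Add_Cmp[symmetric, OF _ diff_hom] diff_Add)

lemma zero_object_hom_eq_Zer:
  "zero_object X Z \<Longrightarrow> f \<in> homs X Z A \<Longrightarrow> f = Zer X Z A"
  "zero_object X Z \<Longrightarrow> f \<in> homs X A Z \<Longrightarrow> f = Zer X A Z"
  using zero_object_unique[of Z f] Zer_hom hom_obj[of f] by auto

lemma zero_object_Ide: "zero_object X Z \<Longrightarrow> Ide X Z = Zer X Z Z"
  using zero_object_hom_eq_Zer(1) Ide_hom unfolding zero_object_def by blast

lemma biproduct_swap: "biproduct X A B P i j p q \<Longrightarrow> biproduct X B A P j i q p"
  unfolding biproduct_def using Add_commute[OF Cmp_hom Cmp_hom, of p P A i P q B j] by auto

lemma biproduct_zero_left: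
  assumes "A \<in> Obj X" "zero_object X Z"
  shows "biproduct X Z A A (Zer X Z A) (Ide X A) (Zer X A Z) (Ide X A)"
proof -
  have Z: "Z \<in> Obj X" using assms by (simp add: zero_object_def)
  show ?thesis
    unfolding biproduct_def using assms Z Zer_hom[OF Z assms(1)] Zer_hom[OF assms(1) Z] 
      Ide_hom[OF assms(1)] zero_object_Ide[OF assms(2)]
    by (auto simp: Cmp_Zer Zer_Cmp Cmp_Ide Ide_Cmp Zer_Add)
qed

lemmas biproduct_zero_right = biproduct_swap[OF biproduct_zero_left]

text \<open>If \<open>1 - i p\<close>, which kills \<open>i\<close>, factors as \<open>j q\<close> through an epimorphism \<open>q\<close>, then \<open>j\<close> is the missing
  injection: the equations for \<open>q j\<close> and \<open>p j\<close> may be checked after composing with \<open>q\<close>.\<close>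

lemma biproduct_from_retraction:
  assumes i: "i \<in> homs X A P" and p: "p \<in> homs X P A" and q: "q \<in> homs X P B"
    and pi: "p \<cdot> i = Ide X A" and qi: "q \<cdot> i = Zer X A B"
    and j: "j \<in> homs X B P" and jq: "j \<cdot> q = Ide X P \<boxminus> (i \<cdot> p)"
    and epi: "\<And>T f g. f \<in> homs X B T \<Longrightarrow> g \<in> homs X B T \<Longrightarrow> f \<cdot> q = g \<cdot> q \<Longrightarrow> f = g"
  shows "biproduct X A B P i j p q"
proof -
  note O = hom_obj(1)[OF i] hom_obj(2)[OF i] hom_obj(2)[OF q]
  note ip = Cmp_hom[OF p i] and I = Ide_hom[OF O(2)]
  have "(q \<cdot> j) \<cdot> q = q \<cdot> (j \<cdot> q)" using Cmp_assoc[OF q j q] by simp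
  also have "\<dots> = q \<cdot> Ide X P \<boxminus> q \<cdot> (i \<cdot> p)" using jq Cmp_diff[OF I ip q] by simp
  also have "q \<cdot> (i \<cdot> p) = Zer X P B" using qi Cmp_assoc[OF p i q] Zer_Cmp[OF p] O by simp
  also have "q \<cdot> Ide X P \<boxminus> Zer X P B = Ide X B \<cdot> q"
    using q O by (auto intro!: diff_eqI[of _ P B] Zer_hom simp: Cmp_Ide Ide_Cmp Add_Zer)
  finally have qj: "q \<cdot> j = Ide X B" 
    by (rule epi[rotated 2]) (auto intro: Cmp_hom j q Ide_hom O)
  have "(p \<cdot> j) \<cdot> q = p \<cdot> (j \<cdot> q)" using Cmp_assoc[OF q j p] by simp
  also have "\<dots> = p \<cdot> Ide X P \<boxminus> p \<cdot> (i \<cdot> p)" using jq Cmp_diff[OF I ip p] by simp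
  also have "p \<cdot> (i \<cdot> p) = p" using pi Cmp_assoc[OF p i p] Ide_Cmp[OF p] by simp
  also have "p \<cdot> Ide X P \<boxminus> p = Zer X B A \<cdot> q"
    using p q O by (simp add: Cmp_Ide diff_self Zer_Cmp)
  finally have pj: "p \<cdot> j = Zer X B A"
    by (rule epi[rotated 2]) (auto intro: Cmp_hom j p q Zer_hom O)
  have "(i \<cdot> p) \<boxplus> (j \<cdot> q) = Ide X P"
    using jq diff_Add[OF I ip] Add_commute[OF ip Cmp_hom[OF q j]] by simp
  then show ?thesis unfolding biproduct_def using assms O qj pj by auto
qed

text \<open>The injection of \<open>A\<close> may be replaced by the graph of any \<open>h : A \<rightarrow> B\<close>, at the price of changing the
  projection to \<open>B\<close>; so a morphism \<open>(f, h f)\<close> into \<open>A \<oplus> B\<close> can be treated as \<open>(f, 0)\<close>.\<close>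

lemma biproduct_shear:
  assumes bp: "biproduct X A B P i j p q" and h: "h \<in> homs X A B"
  shows "biproduct X A B P (i \<boxplus> j \<cdot> h) j p (q \<boxminus> h \<cdot> p)"
proof -
  have O: "A \<in> Obj X" "B \<in> Obj X" "P \<in> Obj X"
    and i: "i \<in> homs X A P" and j: "j \<in> homs X B P" and p: "p \<in> homs X P A" and q: "q \<in> homs X P B"
    and e: "p \<cdot> i = Ide X A" "q \<cdot> j = Ide X B" "q \<cdot> i = Zer X A B" "p \<cdot> j = Zer X B A"
    "(i \<cdot> p) \<boxplus> (j \<cdot> q) = Ide X P" using bp by (auto simp: biproduct_def)
  note jh = Cmp_hom[OF h j] and hp = Cmp_hom[OF p h]
  note u = Add_hom[OF i jh] and v = diff_hom[OF q hp]
  have pjh: "p \<cdot> (j \<cdot> h) = Zer X A A" using Cmp_assoc[OF h j p] e Zer_Cmp[OF h] O by simp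
  have hpj: "(h \<cdot> p) \<cdot> j = Zer X B B" using Cmp_assoc[OF j p h] e Cmp_Zer[OF h] O by simp
  have 1: "p \<cdot> (i \<boxplus> j \<cdot> h) = Ide X A"
    using Cmp_Add[OF i jh p] pjh e O by (simp add: Add_Zer Ide_hom)
  have 2: "(q \<boxminus> h \<cdot> p) \<cdot> j = Ide X B"
    using diff_Cmp[OF j q hp] hpj e O
    by (simp, intro diff_eqI[of _ B B]) (auto simp: Add_Zer Ide_hom Zer_hom)
  have "(q \<boxminus> h \<cdot> p) \<cdot> (i \<boxplus> j \<cdot> h) = (q \<cdot> (i \<boxplus> j \<cdot> h)) \<boxminus> h \<cdot> (p \<cdot> (i \<boxplus> j \<cdot> h))"
    using diff_Cmp[OF u q hp] Cmp_assoc[OF u p h] by simp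
  also have "q \<cdot> (i \<boxplus> j \<cdot> h) = h"
    using Cmp_Add[OF i jh q] Cmp_assoc[OF h j q] e Ide_Cmp[OF h] Zer_Add[OF h] by simp
  finally have 3: "(q \<boxminus> h \<cdot> p) \<cdot> (i \<boxplus> j \<cdot> h) = Zer X A B"
    using 1 h by (simp add: Cmp_Ide diff_self)
  note ip = Cmp_hom[OF p i] and jq = Cmp_hom[OF q j] and jhp = Cmp_hom[OF hp j] and 
    jv = Cmp_hom[OF v j]
  have "((i \<boxplus> j \<cdot> h) \<cdot> p) \<boxplus> (j \<cdot> (q \<boxminus> h \<cdot> p))
      = (i \<cdot> p \<boxplus> j \<cdot> (h \<cdot> p)) \<boxplus> (j \<cdot> (q \<boxminus> h \<cdot> p))"
    using Add_Cmp[OF p i jh] Cmp_assoc[OF p h j] by simp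
  also have "\<dots> = i \<cdot> p \<boxplus> (j \<cdot> (q \<boxminus> h \<cdot> p) \<boxplus> j \<cdot> (h \<cdot> p))"
    using Add_assoc[OF ip jhp jv] Add_commute[OF jhp jv] by simp
  also have "\<dots> = Ide X P" 
    using Cmp_Add[OF v hp j] diff_Add[OF q hp] e by simp
  finally have 4: "((i \<boxplus> j \<cdot> h) \<cdot> p) \<boxplus> (j \<cdot> (q \<boxminus> h \<cdot> p)) = Ide X P" .
  show ?thesis unfolding biproduct_def using O u j p v 1 2 3 4 e by auto
qed

lemma diff_diff: "f \<in> homs X A B \<Longrightarrow> g \<in> homs X A B \<Longrightarrow> f \<boxminus> (f \<boxminus> g) = g"
  using Add_commute[of g A B "f \<boxminus> g"] diff_Add[of f A B g] diff_hom[of f A B g]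
  by (intro diff_eqI[of _ A B]) auto

lemma biproductD:
  assumes "biproduct X A B P i j p q"
  shows "A \<in> Obj X" "B \<in> Obj X" "P \<in> Obj X" "i \<in> homs X A P" "j \<in> homs X B P"
    "p \<in> homs X P A" "q \<in> homs X P B" "p \<cdot> i = Ide X A" "q \<cdot> j = Ide X B"
    "q \<cdot> i = Zer X A B" "p \<cdot> j = Zer X B A" "(i \<cdot> p) \<boxplus> (j \<cdot> q) = Ide X P"
  using assms by (auto simp: biproduct_def)

lemma biproduct_is_cokernel:
  assumes bp: "biproduct X A B P i j p q"
  shows "is_cokernel X i q"
proof -
  note d = biproductD[OF bp]
  have D: "i \<in> Arr X" "Dom X i = A" "Cod X i = P" "q \<in> Arr X" "Dom X q = P" "Cod X q = B"
    using d by (auto simp: homs_iff)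
  have "\<exists>!u. u \<in> homs X B T \<and> u \<cdot> q = t"
    if T: "T \<in> Obj X" and t: "t \<in> homs X P T" "t \<cdot> i = Zer X A T" for T t
  proof (rule ex1I[of _ "t \<cdot> j"])
    have "t = t \<cdot> ((i \<cdot> p) \<boxplus> (j \<cdot> q))" using d Cmp_Ide[OF t(1)] by simp
    also have "\<dots> = (t \<cdot> i) \<cdot> p \<boxplus> (t \<cdot> j) \<cdot> q"
      using Cmp_Add[OF Cmp_hom[OF d(6,4)] Cmp_hom[OF d(7,5)] t(1)]
        Cmp_assoc[OF d(6,4) t(1)] Cmp_assoc[OF d(7,5) t(1)] by simp
    also have "\<dots> = (t \<cdot> j) \<cdot> q"
      using t Zer_Cmp[OF d(6) T] Zer_Add[OF Cmp_hom[OF d(7) Cmp_hom[OF d(5) t(1)]]] by simp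
    finally show "t \<cdot> j \<in> homs X B T \<and> t \<cdot> j \<cdot> q = t"
      using Cmp_hom[OF d(5) t(1)] by simp
    show "u = t \<cdot> j" if "u \<in> homs X B T \<and> u \<cdot> q = t" for u
      using that Cmp_assoc[OF d(5,7), of u T] d(9) Cmp_Ide[of u B T] by auto
  qed
  then show ?thesis unfolding is_cokernel_def using d D by auto
qed

text \<open>The cokernel of a split monomorphism \<open>i\<close> is the projection to a complement, because \<open>1 - i p\<close> kills \<open>i\<close>
  and hence factors through it.\<close>

lemma split_mono_cokernel_biproduct:
  assumes i: "i \<in> homs X A P" and p: "p \<in> homs X P A" and pi: "p \<cdot> i = Ide X A"
    and k: "is_cokernel X i q"
  obtains B j where "biproduct X A B P i j p q"
proof -
  have q: "q \<in> homs X P (Cod X q)" and qi: "q \<cdot> i = Zer X A (Cod X q)"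
    and u: "\<And>T t. t \<in> homs X P T \<Longrightarrow> t \<cdot> i = Zer X A T 
      \<Longrightarrow> \<exists>!u. u \<in> homs X (Cod X q) T \<and> u \<cdot> q = t"
    using i k hom_obj unfolding is_cokernel_def by (auto simp: homs_iff)
  note O = hom_obj[OF i] and ip = Cmp_hom[OF p i]
  let ?e = "Ide X P \<boxminus> (i \<cdot> p)"
  have e: "?e \<in> homs X P P" using diff_hom[OF Ide_hom[OF O(2)] ip] .
  have "?e \<cdot> i = Zer X A P"
    using diff_Cmp[OF i Ide_hom[OF O(2)] ip] Cmp_assoc[OF i p i] pi 
    by (simp add: Ide_Cmp[OF i] Cmp_Ide[OF i] diff_self[OF i])
  then obtain j where j: "j \<in> homs X (Cod X q) P" "j \<cdot> q = ?e" using u[OF e] by blast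
  have "f = g" if fg: "f \<in> homs X (Cod X q) T" "g \<in> homs X (Cod X q) T" "f \<cdot> q = g \<cdot> q" for T f g
  proof -
    have "(f \<cdot> q) \<cdot> i = Zer X A T"
      using Cmp_assoc[OF i q fg(1)] qi Cmp_Zer[OF fg(1) O(1)] by simp
    then show ?thesis using u[OF Cmp_hom[OF q fg(1)]] fg by auto
  qed
  then have "biproduct X A (Cod X q) P i j p q"
    using biproduct_from_retraction[OF i p q pi qi j] by blast
  then show ?thesis using that by blast
qed

end

section \<open>The opposite of an extriangulated category\<close>

text \<open>Sequences are reversed along with the arrows, so a triangle \<open>A \<rightarrow> B \<rightarrow> C\<close> over an extension in \<open>E(C, A)\<close> becomes
  a triangle \<open>C \<rightarrow> B \<rightarrow> A\<close> over the same extension.\<close>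

definition Op :: "('o, 'm, 'e) extri \<Rightarrow> ('o, 'm, 'e) extri" where
  "Op X = \<lparr>Obj = Obj X, Arr = Arr X, Dom = Cod X, Cod = Dom X, Ide = Ide X,
     Cmp = (\<lambda>g f. f \<cdot>\<^bsub>X\<^esub> g), Add = Add X, Zer = (\<lambda>A B. Zer X B A),
     Ext = (\<lambda>C A. Ext X A C), ExtMap = (\<lambda>c a. ExtMap X a c),
     Rlz = (\<lambda>C A \<delta>. {(y, x). (x, y) \<in> Rlz X A C \<delta>})\<rparr>"

lemma Op_simps [simp]:
  "Obj (Op X) = Obj X" "Arr (Op X) = Arr X" "Dom (Op X) = Cod X" "Cod (Op X) = Dom X"
  "Ide (Op X) = Ide X" "Cmp (Op X) g f = Cmp X f g" "Add (Op X) = Add X"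
  "Zer (Op X) A B = Zer X B A" "Ext (Op X) C A = Ext X A C" "ExtMap (Op X) c a = ExtMap X a c"
  "Rlz (Op X) C A \<delta> = {(y, x). (x, y) \<in> Rlz X A C \<delta>}"
  by (simp_all add: Op_def)

lemma homs_Op [simp]: "homs (Op X) A B = homs X B A"
  by (auto simp: homs_iff)

lemma hom_group_Op [simp]: "hom_group (Op X) A B = hom_group X B A"
  by (simp add: hom_group_def)

lemma is_iso_Op [simp]: "is_iso (Op X) f = is_iso X f"
  by (auto simp: is_iso_def)

lemma zero_object_Op [simp]: "zero_object (Op X) Z = zero_object X Z"
  by (auto simp: zero_object_def)

lemma biproduct_Op [simp]: "biproduct (Op X) A B P i j p q = biproduct X A B P p q i j"
  by (auto simp: biproduct_def)

lemma push_Op [simp]: "push (Op X) C a \<delta> = pull X C a \<delta>"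
  by (simp add: push_def pull_def)

lemma pull_Op [simp]: "pull (Op X) C a \<delta> = push X C a \<delta>"
  by (simp add: push_def pull_def)

lemma realizes_Op [simp]: "realizes (Op X) \<delta> x y = realizes X \<delta> y x"
  by (auto simp: realizes_def)

lemma is_seq_Op [simp]: "is_seq (Op X) A C x y = is_seq X C A y x"
  by (auto simp: is_seq_def)

lemma ext_morphism_Op [simp]:
  "ext_morphism (Op X) C A \<delta> C' A' \<delta>' a c = ext_morphism X A' C' \<delta>' A C \<delta> c a"
  by (auto simp: ext_morphism_def)

lemma ext_sum_Op [simp]: "ext_sum (Op X) CC AA p q i j \<delta> \<delta>' = ext_sum X AA CC i j p q \<delta> \<delta>'"
  by (simp add: ext_sum_def)

lemma iso_closed_Op [simp]: "category X \<Longrightarrow> iso_closed (Op X) U = iso_closed X U"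
proof -
  assume "category X"
  then interpret category X .
  have "isomorphic X A B = isomorphic X B A" for A B
    unfolding isomorphic_def using isoI iso_obtain by metis
  moreover have "isomorphic (Op X) A B = isomorphic X B A" for A B
    by (simp add: isomorphic_def)
  ultimately show ?thesis by (simp add: iso_closed_def)
qed

lemma category_Op: "category X \<Longrightarrow> category (Op X)"
proof -
  assume "category X"
  then interpret category X .
  show ?thesis
    by unfold_locales (auto simp: Dom_Obj Cod_Obj Ide_hom Cmp_Ide Ide_Cmp Cmp_assoc intro: Cmp_hom)
qed

lemma additive_category_Op: "additive_category X \<Longrightarrow> additive_category (Op X)"
proof -
  assume "additive_category X"
  then interpret additive_category X .
  interpret op: category "Op X" by (rule category_Op) unfold_locales
  show ?thesis
  proof (intro additive_category.intro additive_category_axioms.intro op.category_axioms)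
    fix A B assume "A \<in> Obj (Op X)" "B \<in> Obj (Op X)"
    then obtain P i j p q where "biproduct X A B P i j p q"
      using ex_biproduct[of A B] by auto
    then have "biproduct (Op X) A B P p q i j" by simp
    then show "\<exists>P i j p q. biproduct (Op X) A B P i j p q" by blast
  qed (auto simp: hom_comm_group Cmp_Add Add_Cmp ex_zero_object)
qed

lemma additive_bifunctor_Op: "additive_bifunctor X \<Longrightarrow> additive_bifunctor (Op X)"
proof -
  assume "additive_bifunctor X"
  then interpret additive_bifunctor X .
  interpret op: additive_category "Op X" by (rule additive_category_Op) unfold_locales
  show ?thesis
    by (intro additive_bifunctor.intro additive_bifunctor_axioms.intro op.additive_category_axioms)
      (auto simp: Ext_comm_group ExtMap_Ide ExtMap_hom ExtMap_Cmp ExtMap_Add_left ExtMap_Add_right)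
qed

text \<open>Equivalence is tested in the opposite category by an isomorphism in the other direction, so its symmetry
  is what makes a class of sequences self-dual.\<close>

lemma (in category) seq_equiv_sym:
  assumes "is_seq X A C x y" "is_seq X A C x' y'" "seq_equiv X x y x' y'"
  shows "seq_equiv X x' y' x y"
proof -
  from assms obtain b where b: "b \<in> homs X (Cod X x) (Cod X x')" "is_iso X b" "b \<cdot> x = x'"
    "y' \<cdot> b = y" by (auto simp: seq_equiv_def)
  obtain b' where b': "b' \<in> homs X (Cod X x') (Cod X x)" "b' \<cdot> b = Ide X (Cod X x)"
    "b \<cdot> b' = Ide X (Cod X x')" using iso_obtain b by blast
  have x: "x \<in> homs X A (Cod X x)" and y': "y' \<in> homs X (Cod X x') C"
    using assms by (auto simp: is_seq_def homs_iff)
  have "b' \<cdot> x' = x" using Cmp_assoc[OF x b(1) b'(1)] b b' Ide_Cmp[OF x] by simp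
  moreover have "y \<cdot> b' = y'" using Cmp_assoc[OF b'(1) b(1) y'] b b' Cmp_Ide[OF y'] by simp
  ultimately show ?thesis using b b' isoI unfolding seq_equiv_def by blast
qed

lemma seq_equiv_Op:
  assumes "category X" "is_seq X A C x y" "is_seq X A C x' y'"
  shows "seq_equiv (Op X) y x y' x' = seq_equiv X x y x' y'"
proof -
  have "seq_equiv (Op X) y x y' x' = seq_equiv X x' y' x y"
    using assms(2,3) by (auto simp: seq_equiv_def is_seq_def)
  then show ?thesis using category.seq_equiv_sym[OF assms(1)] assms(2,3) by blast
qed

text \<open>Reversing a morphism of extensions exchanges its two components. The split sequence
  on a direct sum reverses to the split sequence in which the two summands trade places.\<close>

lemma additive_realization_Op: "additive_realization X \<Longrightarrow> additive_realization (Op X)"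
proof -
  assume "additive_realization X"
  then interpret additive_realization X .
  interpret op: additive_bifunctor "Op X" by (rule additive_bifunctor_Op) unfold_locales
  show ?thesis
  proof (unfold_locales, goal_cases)
    case (1 C A \<delta>)
    then obtain x y where xy: "is_seq X C A x y"
      "Rlz X A C \<delta> = {(x', y'). is_seq X C A x' y' \<and> seq_equiv X x y x' y'}"
      using Rlz_class[of A C \<delta>] by auto
    have "Rlz (Op X) C A \<delta>
      = {(x', y'). is_seq (Op X) A C x' y' \<and> seq_equiv (Op X) y x x' y'}"
      using xy seq_equiv_Op[OF category_axioms xy(1)] by auto
    then show ?case using xy(1) by fastforce
  next
    case (2 \<delta> x y \<delta>' x' y' a c)
    then show ?case 
      using Rlz_morphism[of \<delta>' y' x' \<delta> y x c a] by (fastforce simp: realizes_def)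
  next
    case (3 A C P i j p q)
    then have "biproduct X C A P q p j i" using biproduct_swap by simp
    then show ?case using Rlz_zero by simp
  next
    case (4 \<delta> x y \<delta>' x' y' AA iA jA pA qA BB iB jB pB qB CC iC jC pC qC)
    have a: "arr_sum (Op X) p q i j f f' = arr_sum X i j p q f f'"
      if "i \<in> homs X Q (Dom X f)" "j \<in> homs X Q (Dom X f')" 
        "p \<in> homs X (Cod X f) P" "q \<in> homs X (Cod X f') P" 
        "f \<in> Arr X" "f' \<in> Arr X" for p q i j f f' P Q
    proof -
      have "f \<in> homs X (Dom X f) (Cod X f)" "f' \<in> homs X (Dom X f') (Cod X f')"
        using that by (auto simp: homs_iff)
      from Cmp_assoc[OF that(1) this(1) that(3)] Cmp_assoc[OF that(2) this(2) that(4)]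
      show ?thesis by (simp add: arr_sum_def)
    qed
    have 1: "arr_sum (Op X) pA qA iB jB x x' = arr_sum X iB jB pA qA x x'"
      using 4 by (intro a) (auto simp: biproduct_def realizes_def)
    have 2: "arr_sum (Op X) pB qB iC jC y y' = arr_sum X iC jC pB qB y y'"
      using 4 by (intro a) (auto simp: biproduct_def realizes_def)
    have "Cod X y = Dom X x" "Cod X y' = Dom X x'"
      using 4 by (auto simp: realizes_def)
    then show ?case 
      using Rlz_sum[of \<delta> y x \<delta>' y' x' CC pC qC iC jC BB pB qB iB jB AA pA qA iA jA] 4
      by (simp add: 1 2)
  qed
qed

lemma extriangulated_category_Op: "extriangulated_category X \<Longrightarrow> extriangulated_category (Op X)"
proof -
  assume "extriangulated_category X"
  then interpret extriangulated_category X .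
  interpret op: additive_realization "Op X" by (rule additive_realization_Op) unfold_locales
  show ?thesis
  proof (unfold_locales, goal_cases)
    case (1 \<delta> x y \<delta>' x' y' a b)
    then show ?case using ET3_op[of \<delta>' y' x' \<delta> y x b a]
      by (fastforce simp: realizes_def)
  next
    case (2 \<delta> x y \<delta>' x' y' b c)
    then have "Cod X y = Dom X x" "Cod X y' = Dom X x'"
      by (auto simp: realizes_def)
    then obtain a where "a \<in> homs X (Cod X x') (Cod X x)" "a \<cdot>\<^bsub>X\<^esub> x' = x \<cdot>\<^bsub>X\<^esub> b"
      "push X (Cod X x') c \<delta>' = pull X (Dom X y) a \<delta>"
      using ET3[of \<delta>' y' x' \<delta> y x c b] 2 by auto
    then show ?case by (intro bexI[of _ a]) simp_all
  next
    case (3 f A B f' D \<delta> g C g' F \<delta>')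
    then show ?case using ET4_op[of f' D B f A \<delta> g' F C g \<delta>'] by simp
  next
    case (4 f' D B f A \<delta> g' F C g \<delta>')
    then show ?case using ET4[of f A B f' D \<delta> g C g' F \<delta>'] by simp
  qed
qed

section \<open>Exactness\<close>

context additive_bifunctor
begin

lemma Ext_one: "C \<in> Obj X \<Longrightarrow> A \<in> Obj X \<Longrightarrow> \<one>\<^bsub>Ext X C A\<^esub> \<in> carrier (Ext X C A)"
  using Ext_comm_group[of C A] by (simp add: comm_group_def group_def monoid.one_closed)

lemma Ext_idem_one:
  assumes "C \<in> Obj X" "A \<in> Obj X" "e \<in> carrier (Ext X C A)" "e \<otimes>\<^bsub>Ext X C A\<^esub> e = e"
  shows "e = \<one>\<^bsub>Ext X C A\<^esub>"
proof -
  interpret G: comm_group "Ext X C A" using assms by (intro Ext_comm_group)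
  show ?thesis using assms by simp
qed

lemma ExtMap_one:
  assumes c: "c \<in> homs X C' C" and a: "a \<in> homs X A A'"
  shows "ExtMap X c a \<one>\<^bsub>Ext X C A\<^esub> = \<one>\<^bsub>Ext X C' A'\<^esub>"
proof -
  interpret G: group "Ext X C A" 
    using Ext_comm_group hom_obj[OF c] hom_obj[OF a] by (simp add: comm_group_def)
  interpret H: group "Ext X C' A'" 
    using Ext_comm_group hom_obj[OF c] hom_obj[OF a] by (simp add: comm_group_def)
  interpret group_hom "Ext X C A" "Ext X C' A'" "ExtMap X c a"
    using ExtMap_hom[OF c a] by unfold_locales
  show ?thesis by simp
qed

lemma push_closed: "\<delta> \<in> carrier (Ext X C A) \<Longrightarrow> a \<in> homs X A A' \<Longrightarrow> C \<in> Obj X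
    \<Longrightarrow> push X C a \<delta> \<in> carrier (Ext X C A')"
  using ExtMap_hom[of "Ide X C" C C a A A'] Ide_hom[of C] by (auto simp: push_def hom_def)

lemma push_one: "a \<in> homs X A A' \<Longrightarrow> C \<in> Obj X
    \<Longrightarrow> push X C a \<one>\<^bsub>Ext X C A\<^esub> = \<one>\<^bsub>Ext X C A'\<^esub>"
  by (simp add: push_def ExtMap_one Ide_hom)

lemma push_Ide: "\<delta> \<in> carrier (Ext X C A) \<Longrightarrow> A \<in> Obj X \<Longrightarrow> C \<in> Obj X
    \<Longrightarrow> push X C (Ide X A) \<delta> = \<delta>"
  by (simp add: push_def ExtMap_Ide)

lemma push_Cmp: "\<delta> \<in> carrier (Ext X C A) \<Longrightarrow> a \<in> homs X A A' \<Longrightarrow> a' \<in> homs X A' A'' \<Longrightarrow> C \<in> Obj X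
    \<Longrightarrow> push X C (a' \<cdot> a) \<delta> = push X C a' (push X C a \<delta>)"
  using ExtMap_Cmp[of "Ide X C" C C "Ide X C" C a A A' a' A'' \<delta>]
  by (simp add: push_def Ide_hom Cmp_Ide[OF Ide_hom])

lemma push_pull_commute:
  assumes "\<delta> \<in> carrier (Ext X C A)" "a \<in> homs X A A'" "c \<in> homs X C' C"
  shows "push X C' a (pull X A c \<delta>) = pull X A' c (push X C a \<delta>)"
proof -
  have o: "C \<in> Obj X" "C' \<in> Obj X" "A \<in> Obj X" "A' \<in> Obj X"
    using hom_obj assms by blast+
  show ?thesis
    using ExtMap_Cmp[of c C' C "Ide X C'" C' "Ide X A" A A a A' \<delta>]
      ExtMap_Cmp[of "Ide X C" C C c C' a A A' "Ide X A'" A' \<delta>] assms o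
    by (simp add: push_def pull_def Ide_hom Cmp_Ide Ide_Cmp)
qed

lemma push_Add: "\<delta> \<in> carrier (Ext X C A) \<Longrightarrow> a \<in> homs X A A' \<Longrightarrow> b \<in> homs X A A' \<Longrightarrow> C \<in> Obj X
    \<Longrightarrow> push X C (a \<boxplus> b) \<delta> = push X C a \<delta> \<otimes>\<^bsub>Ext X C A'\<^esub> push X C b \<delta>"
  unfolding push_def by (rule ExtMap_Add_right[OF Ide_hom])

lemma push_Zer:
  assumes "\<delta> \<in> carrier (Ext X C A)" "A \<in> Obj X" "A' \<in> Obj X" "C \<in> Obj X"
  shows "push X C (Zer X A A') \<delta> = \<one>\<^bsub>Ext X C A'\<^esub>"
  using push_Add[OF assms(1) Zer_hom Zer_hom assms(4)] push_closed[OF assms(1) Zer_hom] assms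
  by (intro Ext_idem_one) (auto simp: Add_Zer Zer_hom)

end

text \<open>An \<open>E\<close>-triangle together with its three objects: the extension alone does not determine them, and the exactness
  statements below refer to all three.\<close>

definition etriangle ::
  "('o, 'm, 'e, 'z) extri_scheme \<Rightarrow> 'e \<Rightarrow> 'o \<Rightarrow> 'm \<Rightarrow> 'o \<Rightarrow> 'm \<Rightarrow> 'o \<Rightarrow> bool" where
  "etriangle X \<delta> A x B y C \<longleftrightarrow> x \<in> homs X A B \<and> y \<in> homs X B C \<and> realizes X \<delta> x y"

lemma etriangle_Op [simp]: "etriangle (Op X) \<delta> C y B x A = etriangle X \<delta> A x B y C"
  by (auto simp: etriangle_def)

lemma realizes_etriangle: "realizes X \<delta> x y \<Longrightarrow> etriangle X \<delta> (Dom X x) x (Cod X x) y (Cod X y)"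
  by (auto simp: etriangle_def realizes_def homs_iff)

text \<open>The opposite is a record without further fields, so statements can be dualized only in categories
  of that type.\<close>

locale extriangulated = extriangulated_category X for X :: "('o, 'm, 'e) extri" (structure)
begin

lemma dual: "extriangulated (Op X)"
  using extriangulated_category_Op[OF extriangulated_category_axioms] by (rule extriangulated.intro)

lemma pull_closed: "\<delta> \<in> carrier (Ext X C A) \<Longrightarrow> c \<in> homs X C' C \<Longrightarrow> A \<in> Obj X
    \<Longrightarrow> pull X A c \<delta> \<in> carrier (Ext X C' A)"
  using additive_bifunctor.push_closed[OF additive_bifunctor_Op[OF additive_bifunctor_axioms]] by simp

lemma pull_one: "c \<in> homs X C' C \<Longrightarrow> A \<in> Obj X
    \<Longrightarrow> pull X A c \<one>\<^bsub>Ext X C A\<^esub> = \<one>\<^bsub>Ext X C' A\<^esub>"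
  using additive_bifunctor.push_one[OF additive_bifunctor_Op[OF additive_bifunctor_axioms]] by simp

lemma pull_Ide: "\<delta> \<in> carrier (Ext X C A) \<Longrightarrow> A \<in> Obj X \<Longrightarrow> C \<in> Obj X
    \<Longrightarrow> pull X A (Ide X C) \<delta> = \<delta>"
  using additive_bifunctor.push_Ide[OF additive_bifunctor_Op[OF additive_bifunctor_axioms]] by simp

lemma pull_Cmp: "\<delta> \<in> carrier (Ext X C A) \<Longrightarrow> c \<in> homs X C' C \<Longrightarrow> c' \<in> homs X C'' C' \<Longrightarrow> A \<in> Obj X
    \<Longrightarrow> pull X A (c \<cdot> c') \<delta> = pull X A c' (pull X A c \<delta>)"
  using additive_bifunctor.push_Cmp[OF additive_bifunctor_Op[OF additive_bifunctor_axioms], 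
      of \<delta> A C c C' c' C''] by simp

lemma pull_Add: "\<delta> \<in> carrier (Ext X C A) \<Longrightarrow> c \<in> homs X C' C \<Longrightarrow> d \<in> homs X C' C \<Longrightarrow> A \<in> Obj X
    \<Longrightarrow> pull X A (c \<boxplus> d) \<delta> = pull X A c \<delta> \<otimes>\<^bsub>Ext X C' A\<^esub> pull X A d \<delta>"
  using additive_bifunctor.push_Add[OF additive_bifunctor_Op[OF additive_bifunctor_axioms],
      of \<delta> A C c C' d] by simp

lemma pull_Zer:
  "\<delta> \<in> carrier (Ext X C A) \<Longrightarrow> A \<in> Obj X \<Longrightarrow> C' \<in> Obj X \<Longrightarrow> C \<in> Obj X
    \<Longrightarrow> pull X A (Zer X C' C) \<delta> = \<one>\<^bsub>Ext X C' A\<^esub>"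
  using additive_bifunctor.push_Zer[OF additive_bifunctor_Op[OF additive_bifunctor_axioms],
      of \<delta> A C C'] by simp

lemma pull_diff_one_iff:
  assumes \<delta>: "\<delta> \<in> carrier (Ext X C A)" and c: "c \<in> homs X C' C" "d \<in> homs X C' C" and A: "A \<in> Obj X"
  shows "pull X A (c \<boxminus> d) \<delta> = \<one>\<^bsub>Ext X C' A\<^esub> \<longleftrightarrow> pull X A c \<delta> = pull X A d \<delta>"
proof -
  interpret G: comm_group "Ext X C' A" using A hom_obj[OF c(1)] by (intro Ext_comm_group)
  have "pull X A c \<delta> = pull X A (c \<boxminus> d) \<delta> \<otimes>\<^bsub>Ext X C' A\<^esub> pull X A d \<delta>"
    using pull_Add[OF \<delta> diff_hom[OF c] c(2) A] diff_Add[OF c] by simp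
  then show ?thesis
    using pull_closed[OF \<delta> diff_hom[OF c] A] pull_closed[OF \<delta> c(2) A] by simp
qed

lemma etriangleD:
  assumes "etriangle X \<delta> A x B y C"
  shows "x \<in> homs X A B" "y \<in> homs X B C" "\<delta> \<in> carrier (Ext X C A)" "realizes X \<delta> x y"
    "A \<in> Obj X" "B \<in> Obj X" "C \<in> Obj X"
  using assms hom_obj[of x A B] hom_obj[of y B C]
  by (auto simp: etriangle_def realizes_def homs_iff)

lemma etriangle_exists:
  assumes "C \<in> Obj X" "A \<in> Obj X" "\<delta> \<in> carrier (Ext X C A)"
  obtains x B y where "etriangle X \<delta> A x B y C"
proof -
  obtain x y where xy: "is_seq X A C x y" 
    "Rlz X C A \<delta> = {(x', y'). is_seq X A C x' y' \<and> seq_equiv X x y x' y'}"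
    using Rlz_class[OF assms] by blast
  then have h: "x \<in> homs X A (Cod X x)" "y \<in> homs X (Cod X x) C" by (auto simp: is_seq_def homs_iff)
  have "seq_equiv X x y x y"
    unfolding seq_equiv_def using Ide_hom[OF hom_obj(2)[OF h(1)]] isoI Cmp_Ide Ide_Cmp h
    by (intro bexI[of _ "Ide X (Cod X x)"]) auto
  then have "etriangle X \<delta> A x (Cod X x) y C"
    using xy h assms by (auto simp: etriangle_def realizes_def is_seq_def)
  then show ?thesis using that by blast
qed

lemma etriangle_equiv:
  assumes t: "etriangle X \<delta> A x B y C" and t': "etriangle X \<delta> A x' B' y' C"
  obtains b where "b \<in> homs X B B'" "is_iso X b" "b \<cdot> x = x'" "y' \<cdot> b = y"
proof -
  note d = etriangleD[OF t] and d' = etriangleD[OF t']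
  obtain x0 y0 where xy: "is_seq X A C x0 y0" 
    "Rlz X C A \<delta> = {(x', y'). is_seq X A C x' y' \<and> seq_equiv X x0 y0 x' y'}"
    using Rlz_class[OF d(7) d(5) d(3)] by blast
  have s: "is_seq X A C x y" "seq_equiv X x0 y0 x y" "is_seq X A C x' y'" "seq_equiv X x0 y0 x' y'"
    using xy d d' by (auto simp: realizes_def homs_iff)
  obtain b where b: "b \<in> homs X B (Cod X x0)" "is_iso X b" "b \<cdot> x = x0" "y0 \<cdot> b = y"
    using seq_equiv_sym[OF xy(1) s(1,2)] d(1) by (auto simp: seq_equiv_def homs_iff)
  obtain c where c: "c \<in> homs X (Cod X x0) B'" "is_iso X c" "c \<cdot> x0 = x'" "y' \<cdot> c = y0"
    using s(4) d'(1) by (auto simp: seq_equiv_def homs_iff)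
  show ?thesis
  proof (rule that[of "c \<cdot> b"])
    show "(c \<cdot> b) \<cdot> x = x'" "y' \<cdot> (c \<cdot> b) = y"
      using Cmp_assoc[OF d(1) b(1) c(1)] Cmp_assoc[OF b(1) c(1) d'(2)] b c by auto
  qed (use iso_Cmp b c Cmp_hom in blast)+
qed

lemma etriangle_change_middle:
  assumes t: "etriangle X \<delta> A x B y C" and b: "b \<in> homs X B B'" "is_iso X b"
    and y': "y' \<in> homs X B' C" "y' \<cdot> b = y"
  shows "etriangle X \<delta> A (b \<cdot> x) B' y' C"
proof -
  note d = etriangleD[OF t]
  obtain x0 y0 where xy: "is_seq X A C x0 y0" 
    "Rlz X C A \<delta> = {(x', y'). is_seq X A C x' y' \<and> seq_equiv X x0 y0 x' y'}"
    using Rlz_class[OF d(7) d(5) d(3)] by blast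
  have s: "seq_equiv X x0 y0 x y" 
    using xy d by (auto simp: realizes_def homs_iff)
  obtain c where c: "c \<in> homs X (Cod X x0) B" "is_iso X c" "c \<cdot> x0 = x" "y \<cdot> c = y0"
    using s d(1) by (auto simp: seq_equiv_def homs_iff)
  have x0: "x0 \<in> homs X A (Cod X x0)" using xy by (auto simp: is_seq_def homs_iff)
  have bx: "b \<cdot> x \<in> homs X A B'" using d b Cmp_hom by blast
  have "seq_equiv X x0 y0 (b \<cdot> x) y'"
    unfolding seq_equiv_def
  proof (intro bexI[of _ "b \<cdot> c"] conjI)
    show "is_iso X (b \<cdot> c)" using iso_Cmp b c by blast
    show "(b \<cdot> c) \<cdot> x0 = b \<cdot> x" "y' \<cdot> (b \<cdot> c) = y0"
      using Cmp_assoc[OF x0 c(1) b(1)] Cmp_assoc[OF c(1) b(1) y'(1)] c y' by auto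
    show "b \<cdot> c \<in> homs X (Cod X x0) (Cod X (b \<cdot> x))"
      using bx b c Cmp_hom by (auto simp: homs_iff)
  qed
  then show ?thesis using bx y' d(3) xy
    by (auto simp: etriangle_def realizes_def is_seq_def homs_iff)
qed

lemma etriangle_morphism:
  assumes t: "etriangle X \<delta> A x B y C" and t': "etriangle X \<delta>' A' x' B' y' C'"
    and "a \<in> homs X A A'" "c \<in> homs X C C'" "push X C a \<delta> = pull X A' c \<delta>'"
  obtains b where "b \<in> homs X B B'" "b \<cdot> x = x' \<cdot> a" "y' \<cdot> b = c \<cdot> y"
  using Rlz_morphism[of \<delta> x y \<delta>' x' y' a c] etriangleD[OF t] etriangleD[OF t'] assms
  by (auto simp: homs_iff ext_morphism_def)

lemma etriangle_ET3:
  assumes t: "etriangle X \<delta> A x B y C" and t': "etriangle X \<delta>' A' x' B' y' C'"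
    and "a \<in> homs X A A'" "b \<in> homs X B B'" "b \<cdot> x = x' \<cdot> a"
  obtains c where "c \<in> homs X C C'" "c \<cdot> y = y' \<cdot> b" "push X C a \<delta> = pull X A' c \<delta>'"
  using ET3[of \<delta> x y \<delta>' x' y' a b] etriangleD[OF t] etriangleD[OF t'] assms
  by (auto simp: homs_iff)

lemma etriangle_zero:
  "biproduct X A C P i j p q \<Longrightarrow> etriangle X \<one>\<^bsub>Ext X C A\<^esub> A i P q C"
  using Rlz_zero by (simp add: etriangle_def biproduct_def)

lemma etriangle_Ide_left:
  "A \<in> Obj X \<Longrightarrow> zero_object X Z \<Longrightarrow> etriangle X \<one>\<^bsub>Ext X A Z\<^esub> Z (Zer X Z A) A (Ide X A) A"
  using etriangle_zero[OF biproduct_zero_left] by simp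

lemma etriangle_Ide_right:
  "A \<in> Obj X \<Longrightarrow> zero_object X Z \<Longrightarrow> etriangle X \<one>\<^bsub>Ext X Z A\<^esub> A (Ide X A) A (Zer X A Z) Z"
  using etriangle_zero[OF biproduct_zero_right] by simp

text \<open>Comparing a triangle with the trivial triangle \<open>A \<rightarrow> A \<rightarrow> 0\<close> or \<open>B \<rightarrow> B \<rightarrow> 0\<close> by (ET3) gives
  the vanishing of \<open>y x\<close> and of \<open>x\<^sub>*\<delta>\<close>, because the induced morphism of cones starts or ends at \<open>0\<close>.\<close>

lemma etriangle_Cmp_Zer:
  assumes t: "etriangle X \<delta> A x B y C"
  shows "y \<cdot> x = Zer X A C"
proof -
  note d = etriangleD[OF t]
  obtain Z where Z: "zero_object X Z" using ex_zero_object by blast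
  note t0 = etriangle_Ide_right[OF d(5) Z]
  obtain c where "c \<in> homs X Z C" "c \<cdot> Zer X A Z = y \<cdot> x"
    by (rule etriangle_ET3[OF t0 t Ide_hom[OF d(5)] d(1)]) (use that in auto)
  then show ?thesis using Cmp_Zer d(5) by simp
qed

lemma etriangle_push_one:
  assumes t: "etriangle X \<delta> A x B y C"
  shows "push X C x \<delta> = \<one>\<^bsub>Ext X C B\<^esub>"
proof -
  note d = etriangleD[OF t]
  obtain Z where Z: "zero_object X Z" using ex_zero_object by blast
  note t0 = etriangle_Ide_right[OF d(6) Z]
  obtain c where "c \<in> homs X C Z" "push X C x \<delta> = pull X B c \<one>\<^bsub>Ext X Z B\<^esub>"
    by (rule etriangle_ET3[OF t t0 d(1) Ide_hom[OF d(6)]]) (use that in auto)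
  then show ?thesis using pull_one d by simp
qed

lemma etriangle_pull_one:
  assumes t: "etriangle X \<delta> A x B y C"
  shows "pull X A y \<delta> = \<one>\<^bsub>Ext X B A\<^esub>"
  using extriangulated.etriangle_push_one[OF dual, of \<delta> C y B x A] t by simp

text \<open>Exactness of \<open>Hom(B,T) \<rightarrow> Hom(A,T) \<rightarrow> E(C,T)\<close>: when \<open>f\<^sub>*\<delta>\<close> vanishes, \<open>f\<close> and \<open>C \<rightarrow> 0\<close> form a morphism to
  the trivial triangle \<open>T \<rightarrow> T \<rightarrow> 0\<close>, whose middle component is the extension of \<open>f\<close>.\<close>

lemma extend_along_inflation:
  assumes t: "etriangle X \<delta> A x B y C" and f: "f \<in> homs X A T" "push X C f \<delta> = \<one>\<^bsub>Ext X C T\<^esub>"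
  obtains g where "g \<in> homs X B T" "g \<cdot> x = f"
proof -
  note d = etriangleD[OF t] and T = hom_obj(2)[OF f(1)]
  obtain Z where Z: "zero_object X Z" using ex_zero_object by blast
  then have ZO: "Z \<in> Obj X" by (simp add: zero_object_def)
  note t0 = etriangle_Ide_right[OF T Z] and z = Zer_hom[OF d(7) ZO]
  obtain b where "b \<in> homs X B T" "b \<cdot> x = Ide X T \<cdot> f"
    by (rule etriangle_morphism[OF t t0 f(1) z]) (use f pull_one[OF z T] that in auto)
  then show ?thesis using that Ide_Cmp f by simp
qed

text \<open>Exactness of \<open>Hom(C,T) \<rightarrow> Hom(B,T) \<rightarrow> Hom(A,T)\<close>: apply (ET3) to \<open>A \<rightarrow> 0\<close> and \<open>g\<close>, viewed as
  a morphism to the trivial triangle \<open>0 \<rightarrow> T \<rightarrow> T\<close>.\<close>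

lemma factor_through_deflation:
  assumes t: "etriangle X \<delta> A x B y C" and g: "g \<in> homs X B T" "g \<cdot> x = Zer X A T"
  obtains s where "s \<in> homs X C T" "s \<cdot> y = g"
proof -
  note d = etriangleD[OF t] and T = hom_obj(2)[OF g(1)]
  obtain Z where Z: "zero_object X Z" using ex_zero_object by blast
  then have ZO: "Z \<in> Obj X" by (simp add: zero_object_def)
  note t0 = etriangle_Ide_left[OF T Z] and z = Zer_hom[OF d(5) ZO]
  obtain c where "c \<in> homs X C T" "c \<cdot> y = Ide X T \<cdot> g"
    by (rule etriangle_ET3[OF t t0 z g(1)]) (use g Zer_Cmp[OF z T] that in auto)
  then show ?thesis using that Ide_Cmp g by simp
qed

lemma lift_along_deflation:
  assumes t: "etriangle X \<delta> A x B y C" and f: "f \<in> homs X T C" "pull X A f \<delta> = \<one>\<^bsub>Ext X T A\<^esub>"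
  obtains g where "g \<in> homs X T B" "y \<cdot> g = f"
  using extriangulated.extend_along_inflation[OF dual, of \<delta> C y B x A f T] t f by auto

lemma factor_through_inflation:
  assumes t: "etriangle X \<delta> A x B y C" and g: "g \<in> homs X T B" "y \<cdot> g = Zer X T C"
  obtains s where "s \<in> homs X T A" "x \<cdot> s = g"
  using extriangulated.factor_through_deflation[OF dual, of \<delta> C y B x A g T] t g by auto

text \<open>Exactness of \<open>Hom(T,C) \<rightarrow> E(T,A) \<rightarrow> E(T,B)\<close>: when \<open>x\<close> kills \<open>\<epsilon>\<close>, it extends along the inflation of a
  realization of \<open>\<epsilon>\<close>, and (ET3) compares that realization with the given triangle.\<close>

lemma push_one_imp_pull:
  assumes t: "etriangle X \<delta> A x B y C" and T: "T \<in> Obj X"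
    and e: "\<epsilon> \<in> carrier (Ext X T A)" "push X T x \<epsilon> = \<one>\<^bsub>Ext X T B\<^esub>"
  obtains c where "c \<in> homs X T C" "pull X A c \<delta> = \<epsilon>"
proof -
  note d = etriangleD[OF t]
  obtain m M n where m: "etriangle X \<epsilon> A m M n T"
    using etriangle_exists[OF T d(5) e(1)] .
  obtain b where b: "b \<in> homs X M B" "b \<cdot> m = x"
    using extend_along_inflation[OF m d(1) e(2)] .
  obtain c where "c \<in> homs X T C" "push X T (Ide X A) \<epsilon> = pull X A c \<delta>"
    by (rule etriangle_ET3[OF m t Ide_hom[OF d(5)] b(1)]) (use b Cmp_Ide[OF d(1)] that in auto)
  then show ?thesis using that push_Ide[OF e(1) d(5) T] by simp
qed

lemma etriangle_ET4:
  assumes t: "etriangle X \<delta> A f B f' D" and t': "etriangle X \<delta>' B g C g' F"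
  obtains E d e h' \<delta>'' where "d \<in> homs X D E" "e \<in> homs X E F" "h' \<in> homs X C E"
    "h' \<cdot> g = d \<cdot> f'" "e \<cdot> h' = g'" "etriangle X \<delta>'' A (g \<cdot> f) C h' E"
    "etriangle X (push X F f' \<delta>') D d E e F" "pull X A d \<delta>'' = \<delta>" 
    "push X E f \<delta>'' = pull X B e \<delta>'"
proof -
  note T = etriangleD[OF t] and T' = etriangleD[OF t']
  have gf: "g \<cdot> f \<in> homs X A C" using T T' Cmp_hom by blast
  show ?thesis using ET4[OF T(1,2,4) T'(1,2,4)] that gf unfolding etriangle_def by blast
qed

lemma etriangle_ET4_op:
  assumes t: "etriangle X \<delta> D f' B f A" and t': "etriangle X \<delta>' F g' C g B"
  obtains E d e h' \<delta>'' where "d \<in> homs X E D" "e \<in> homs X F E" "h' \<in> homs X E C"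
    "g \<cdot> h' = f' \<cdot> d" "h' \<cdot> e = g'" "etriangle X \<delta>'' E h' C (f \<cdot> g) A"
    "etriangle X (pull X F f' \<delta>') F e E d D" "push X A d \<delta>'' = \<delta>" 
    "pull X E f \<delta>'' = push X B e \<delta>'"
proof -
  have "etriangle (Op X) \<delta> A f B f' D" "etriangle (Op X) \<delta>' B g C g' F" using t t' by simp_all
  from extriangulated.etriangle_ET4[OF dual this]
  obtain E d e h' \<delta>'' where "d \<in> homs (Op X) D E" "e \<in> homs (Op X) E F" "h' \<in> homs (Op X) C E"
    "h' \<cdot>\<^bsub>Op X\<^esub> g = d \<cdot>\<^bsub>Op X\<^esub> f'" "e \<cdot>\<^bsub>Op X\<^esub> h' = g'" 
    "etriangle (Op X) \<delta>'' A (g \<cdot>\<^bsub>Op X\<^esub> f) C h' E"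
    "etriangle (Op X) (push (Op X) F f' \<delta>') D d E e F" "pull (Op X) A d \<delta>'' = \<delta>" 
    "push (Op X) E f \<delta>'' = pull (Op X) B e \<delta>'" .
  then show ?thesis using that[of d E e h' \<delta>''] by simp
qed

text \<open>Exactness of \<open>E(T,A) \<rightarrow> E(T,B) \<rightarrow> E(T,C)\<close>: composing \<open>x\<close> with the inflation of a realization of \<open>\<epsilon>\<close>,
  axiom (ET4) yields an extension by \<open>A\<close> of the middle object of a triangle over \<open>y\<^sub>*\<epsilon>\<close>. When \<open>y\<^sub>*\<epsilon>\<close> vanishes, a section of the
  deflation in that triangle pulls the composite extension back to a preimage of \<open>\<epsilon>\<close>.\<close>

lemma push_one_imp_push:
  assumes t: "etriangle X \<delta> A x B y C" and T: "T \<in> Obj X"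
    and e: "\<epsilon> \<in> carrier (Ext X T B)" "push X T y \<epsilon> = \<one>\<^bsub>Ext X T C\<^esub>"
  obtains \<epsilon>' where "\<epsilon>' \<in> carrier (Ext X T A)" "push X T x \<epsilon>' = \<epsilon>"
proof -
  note d = etriangleD[OF t]
  obtain m M n where m: "etriangle X \<epsilon> B m M n T"
    using etriangle_exists[OF T d(6) e(1)] .
  obtain E u v h' \<delta>'' where 4: "u \<in> homs X C E" "v \<in> homs X E T"
    "etriangle X \<delta>'' A (m \<cdot> x) M h' E" "etriangle X (push X T y \<epsilon>) C u E v T"
    "push X E x \<delta>'' = pull X B v \<epsilon>"
    using etriangle_ET4[OF t m] by metis
  obtain s where s: "s \<in> homs X T E" "v \<cdot> s = Ide X T"
    by (rule lift_along_deflation[OF 4(4) Ide_hom[OF T]])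
      (use pull_Ide push_closed[OF e(1) d(2) T] e d T that in auto)
  note d'' = etriangleD[OF 4(3)]
  have "push X T x (pull X A s \<delta>'') = pull X B s (push X E x \<delta>'')"
    using push_pull_commute[OF d''(3) d(1) s(1)] .
  also have "\<dots> = pull X B (v \<cdot> s) \<epsilon>"
    using 4(5) pull_Cmp[OF e(1) 4(2) s(1)] d by simp
  also have "\<dots> = \<epsilon>" using s pull_Ide[OF e(1)] d T by simp
  finally show ?thesis using that pull_closed[OF d''(3) s(1)] d by blast
qed

lemma pull_one_imp_pull:
  assumes t: "etriangle X \<delta> A x B y C" and T: "T \<in> Obj X"
    and e: "\<epsilon> \<in> carrier (Ext X B T)" "pull X T x \<epsilon> = \<one>\<^bsub>Ext X A T\<^esub>"
  obtains \<epsilon>' where "\<epsilon>' \<in> carrier (Ext X C T)" "pull X T y \<epsilon>' = \<epsilon>"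
  using extriangulated.push_one_imp_push[OF dual, of \<delta> C y B x A T \<epsilon>] t T e by auto

end

section \<open>Split triangles and uniqueness of cones\<close>

context extriangulated
begin

text \<open>The morphism \<open>c\<close> induced between the two cones is invertible by a five lemma on
  \<open>Hom(T,A) \<rightarrow> Hom(T,B) \<rightarrow> Hom(T,C) \<rightarrow> E(T,A) \<rightarrow> E(T,B)\<close>: with \<open>T = C'\<close> it yields a right inverse \<open>r\<close> of
  \<open>c\<close>, and with \<open>T = C\<close> it cancels \<open>c\<close> in \<open>c (r c - 1) = 0\<close>.\<close>

lemma cone_unique:
  assumes t: "etriangle X \<delta> A x B y C" and t': "etriangle X \<delta>' A x B y' C'"
  obtains c where "c \<in> homs X C C'" "is_iso X c" "c \<cdot> y = y'"
proof -
  note d = etriangleD[OF t] and d' = etriangleD[OF t']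
  note IC' = Ide_hom[OF d'(7)] and IC = Ide_hom[OF d(7)]
  have "Ide X B \<cdot> x = x \<cdot> Ide X A" using Ide_Cmp[OF d(1)] Cmp_Ide[OF d(1)] by simp
  from etriangle_ET3[OF t t' Ide_hom[OF d(5)] Ide_hom[OF d(6)] this]
  obtain c where c: "c \<in> homs X C C'" "c \<cdot> y = y'" "pull X A c \<delta>' = \<delta>"
    using Cmp_Ide[OF d'(2)] push_Ide[OF d(3,5,7)] by metis
  obtain s where s: "s \<in> homs X C' C" "pull X A s \<delta> = \<delta>'"
    using push_one_imp_pull[OF t d'(7) d'(3) etriangle_push_one[OF t']] .
  note cs = Cmp_hom[OF s(1) c(1)]
  have "pull X A (c \<cdot> s \<boxminus> Ide X C') \<delta>' = \<one>\<^bsub>Ext X C' A\<^esub>"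
    using pull_diff_one_iff[OF d'(3) cs IC' d(5)] pull_Cmp[OF d'(3) c(1) s(1) d(5)] 
      pull_Ide[OF d'(3,5,7)] c s by simp
  then obtain m where m: "m \<in> homs X C' B" "y' \<cdot> m = c \<cdot> s \<boxminus> Ide X C'"
    using lift_along_deflation[OF t' diff_hom[OF cs IC']] by metis
  note ym = Cmp_hom[OF m(1) d(2)]
  define r where "r = s \<boxminus> y \<cdot> m"
  have r: "r \<in> homs X C' C" using diff_hom[OF s(1) ym] by (simp add: r_def)
  have cr: "c \<cdot> r = Ide X C'"
    unfolding r_def using Cmp_diff[OF s(1) ym c(1)] Cmp_assoc[OF m(1) d(2) c(1)] m c 
      diff_diff[OF cs IC'] by simp
  note rc = Cmp_hom[OF c(1) r]
  define n where "n = r \<cdot> c \<boxminus> Ide X C"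
  have n: "n \<in> homs X C C" using diff_hom[OF rc IC] by (simp add: n_def)
  have cn: "c \<cdot> n = Zer X C C'"
    unfolding n_def using Cmp_diff[OF rc IC c(1)] Cmp_assoc[OF c(1) r c(1)] cr
    by (simp add: Ide_Cmp[OF c(1)] Cmp_Ide[OF c(1)] diff_self[OF c(1)])
  have "pull X A n \<delta> = \<one>\<^bsub>Ext X C A\<^esub>"
    using pull_Cmp[OF d'(3) c(1) n d(5)] cn c(3) pull_Zer[OF d'(3,5) d(7) d'(7)] by simp
  then obtain m' where m': "m' \<in> homs X C B" "y \<cdot> m' = n"
    using lift_along_deflation[OF t n] by metis
  have "y' \<cdot> m' = Zer X C C'"
    using Cmp_assoc[OF m'(1) d(2) c(1)] c(2) m' cn by simp
  then obtain k where k: "k \<in> homs X C A" "x \<cdot> k = m'"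
    using factor_through_inflation[OF t' m'(1)] by metis
  have "n = Zer X C C"
    using Cmp_assoc[OF k(1) d(1) d(2)] k m' etriangle_Cmp_Zer[OF t] Zer_Cmp[OF k(1) d(7)] by simp
  then have "r \<cdot> c = Ide X C" using diff_Zer_eq[OF rc IC] by (simp add: n_def)
  then show ?thesis using that[OF c(1) isoI[OF c(1) r] c(2)] cr by simp
qed

lemma cocone_unique:
  assumes "etriangle X \<delta> A x B y C" and "etriangle X \<delta>' A' x' B y C"
  obtains a where "a \<in> homs X A' A" "is_iso X a" "x \<cdot> a = x'"
  using extriangulated.cone_unique[OF dual, of \<delta> C y B x A \<delta>' x' A'] assms by auto

text \<open>A retraction \<open>p\<close> of \<open>x\<close> gives \<open>\<delta> = p\<^sub>*x\<^sub>*\<delta> = 0\<close>. Hence \<open>y\<close> has a section and is epic, and since \<open>1 - x p\<close>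
  kills \<open>x\<close> it factors through \<open>y\<close>.\<close>

lemma split_by_retraction:
  assumes t: "etriangle X \<delta> A x B y C" and p: "p \<in> homs X B A" "p \<cdot> x = Ide X A"
  obtains j where "biproduct X A C B x j p y"
proof -
  note d = etriangleD[OF t]
  have "\<delta> = push X C (p \<cdot> x) \<delta>" using p push_Ide[OF d(3,5,7)] by simp
  also have "\<dots> = \<one>\<^bsub>Ext X C A\<^esub>"
    using push_Cmp[OF d(3,1) p(1) d(7)] etriangle_push_one[OF t] push_one[OF p(1) d(7)] by simp
  finally have "pull X A (Ide X C) \<delta> = \<one>\<^bsub>Ext X C A\<^esub>" using pull_Ide[OF d(3,5,7)] by simp
  then obtain s where s: "s \<in> homs X C B" "y \<cdot> s = Ide X C"
    using lift_along_deflation[OF t Ide_hom[OF d(7)]] by metis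
  have epi: "f = g" if "f \<in> homs X C T" "g \<in> homs X C T" "f \<cdot> y = g \<cdot> y" for f g T
    using Cmp_assoc[OF s(1) d(2) that(1)] Cmp_assoc[OF s(1) d(2) that(2)] that s Cmp_Ide by auto
  note xp = Cmp_hom[OF p(1) d(1)]
  have "(Ide X B \<boxminus> x \<cdot> p) \<cdot> x = Zer X A B"
    using diff_Cmp[OF d(1) Ide_hom[OF d(6)] xp] Cmp_assoc[OF d(1) p(1) d(1)] p
    by (simp add: Ide_Cmp[OF d(1)] Cmp_Ide[OF d(1)] diff_self[OF d(1)])
  then obtain j where j: "j \<in> homs X C B" "j \<cdot> y = Ide X B \<boxminus> x \<cdot> p"
    using factor_through_deflation[OF t diff_hom[OF Ide_hom[OF d(6)] xp]] by metis
  show ?thesis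
    using that biproduct_from_retraction[OF d(1) p(1) d(2) p(2) etriangle_Cmp_Zer[OF t] j epi] .
qed

lemma split_by_section:
  assumes t: "etriangle X \<delta> A x B y C" and s: "s \<in> homs X C B" "y \<cdot> s = Ide X C"
  obtains p where "biproduct X A C B x s p y"
proof -
  have "etriangle (Op X) \<delta> C y B x A" "s \<in> homs (Op X) B C" "s \<cdot>\<^bsub>Op X\<^esub> y = Ide (Op X) C"
    using assms by simp_all
  from extriangulated.split_by_retraction[OF dual this]
  obtain p where "biproduct (Op X) C A B y p s x" .
  then show ?thesis using that biproduct_swap[of C A B s x y p] by simp
qed

lemma split_by_zero:
  assumes t: "etriangle X \<one>\<^bsub>Ext X C A\<^esub> A x B y C"
  obtains j p where "biproduct X A C B x j p y"
proof -
  note d = etriangleD[OF t]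
  obtain s where "s \<in> homs X C B" "y \<cdot> s = Ide X C"
    using lift_along_deflation[OF t Ide_hom[OF d(7)]] pull_Ide[OF d(3,5,7)] by metis
  then show ?thesis using split_by_section[OF t] that by metis
qed

text \<open>The shear of the opposite category.\<close>

lemma biproduct_coshear:
  assumes bp: "biproduct X A B P i j p q" and h: "h \<in> homs X A B"
  shows "biproduct X A B P (i \<boxminus> j \<cdot> h) j p (q \<boxplus> h \<cdot> p)"
proof -
  interpret op: additive_category "Op X" 
    using additive_category_Op additive_category_axioms .
  have "op.diff f g = f \<boxminus> g" if fg: "f \<in> homs X C D" "g \<in> homs X C D" for f g C D
    by (rule op.diff_eqI[of _ D C]) (use fg diff_hom[OF fg] diff_Add[OF fg] in auto)
  then have "biproduct X B A P j (i \<boxminus> j \<cdot> h) (q \<boxplus> h \<cdot> p) p"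
    using op.biproduct_shear[of B A P q p j i h] biproduct_swap[OF bp] h 
      Cmp_hom[OF h biproductD(5)[OF bp]] biproductD(4)[OF bp] by auto
  then show ?thesis by (rule biproduct_swap)
qed

text \<open>\<open>(h, u) : A \<oplus> B' \<rightarrow> B\<close> is a deflation because it is the composite of \<open>1 \<oplus> u\<close>, the direct sum of
  two deflations, with \<open>(h, 1) : A \<oplus> B \<rightarrow> B\<close>, a projection up to a shear.\<close>

lemma deflation_pair:
  assumes t: "etriangle X \<rho> K k B' u B" and h: "h \<in> homs X A B" and bp: "biproduct X A B' P i j p q"
  obtains L l \<epsilon> where "etriangle X \<epsilon> L l P (h \<cdot> p \<boxplus> u \<cdot> q) B"
proof -
  note d = etriangleD[OF t] and b = biproductD[OF bp]
  obtain Q i' j' p' q' where bp': "biproduct X A B Q i' j' p' q'"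
    using ex_biproduct[OF b(1) d(7)] by blast
  note b' = biproductD[OF bp']
  obtain Z where Z: "zero_object X Z" using ex_zero_object by blast
  note t0 = etriangle_Ide_left[OF b(1) Z] and bz = biproduct_zero_left[OF d(5) Z]
  note d0 = etriangleD[OF t0] and z = biproductD[OF bz]
  define v where "v = arr_sum X (Zer X K Z) (Ide X K) i j (Zer X Z A) k"
  define w where "w = arr_sum X p q i' j' (Ide X A) u"
  have v: "v \<in> homs X K P"
    unfolding v_def arr_sum_def by (intro Add_hom Cmp_hom) (use z b d d0 in auto)
  have w1: "i' \<cdot> Ide X A \<cdot> p = i' \<cdot> p" using Cmp_Ide[OF b'(4)] by simp
  have w2: "j' \<cdot> u \<cdot> q = j' \<cdot> (u \<cdot> q)" using Cmp_assoc[OF b(7) d(2) b'(5)] by simp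
  note i'p = Cmp_hom[OF b(6) b'(4)] and uq = Cmp_hom[OF b(7) d(2)] 
  note juq = Cmp_hom[OF uq b'(5)] and hp = Cmp_hom[OF b(6) h]
  have w: "w = i' \<cdot> p \<boxplus> j' \<cdot> (u \<cdot> q)" "w \<in> homs X P Q"
    unfolding w_def arr_sum_def w1 w2 using Add_hom[OF i'p juq] by auto
  have D: "Dom X k = K" "Cod X k = B'" "Dom X u = B'" "Cod X u = B" "Dom X (Zer X Z A) = Z"
    "Cod X (Zer X Z A) = A" "Dom X (Ide X A) = A" "Cod X (Ide X A) = A"
    using d d0 by (auto simp: homs_iff)
  have "realizes X (ext_sum X Q K p' q' (Zer X Z K) (Ide X K) \<one>\<^bsub>Ext X A Z\<^esub> \<rho>) v w"
    unfolding v_def w_def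
    by (rule Rlz_sum[OF d0(4) d(4), unfolded D]) (use bz bp bp' in auto)
  then obtain \<gamma> where tw: "etriangle X \<gamma> K v P w Q" using v w by (auto simp: etriangle_def)
  define r where "r = q' \<boxplus> h \<cdot> p'"
  have tr: "etriangle X \<one>\<^bsub>Ext X B A\<^esub> A (i' \<boxminus> j' \<cdot> h) Q r B"
    unfolding r_def by (rule etriangle_zero[OF biproduct_coshear[OF bp' h]])
  have p'w: "p' \<cdot> w = p"
    using Cmp_Add[OF i'p juq b'(6)] Cmp_assoc[OF b(6) b'(4,6)] Cmp_assoc[OF uq b'(5,6)] b' 
      Ide_Cmp[OF b(6)] Zer_Cmp[OF uq b(1)] Add_Zer[OF b(6)] w by simp
  have q'w: "q' \<cdot> w = u \<cdot> q"
    using Cmp_Add[OF i'p juq b'(7)] Cmp_assoc[OF b(6) b'(4,7)] Cmp_assoc[OF uq b'(5,7)] b' 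
      Ide_Cmp[OF uq] Zer_Cmp[OF b(6) d(7)] Zer_Add[OF uq] w by simp
  have "r \<cdot> w = u \<cdot> q \<boxplus> h \<cdot> p"
    unfolding r_def using Add_Cmp[OF w(2) b'(7) Cmp_hom[OF b'(6) h]] Cmp_assoc[OF w(2) b'(6) h]
      p'w q'w by simp
  then have "r \<cdot> w = h \<cdot> p \<boxplus> u \<cdot> q" using Add_commute[OF hp uq] by simp
  then show ?thesis using that etriangle_ET4_op[OF tr tw] by metis
qed

lemma inflation_pair:
  assumes t: "etriangle X \<rho> B u B' k K" and h: "h \<in> homs X B A" and bp: "biproduct X A B' P i j p q"
  obtains L l \<epsilon> where "etriangle X \<epsilon> B (i \<cdot> h \<boxplus> j \<cdot> u) P l L"
proof -
  have "etriangle (Op X) \<rho> K k B' u B" "h \<in> homs (Op X) A B" "biproduct (Op X) A B' P p q i j"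
    using assms by simp_all
  from extriangulated.deflation_pair[OF dual this]
  obtain L l \<epsilon> where "etriangle (Op X) \<epsilon> L l P (h \<cdot>\<^bsub>Op X\<^esub> i \<boxplus>\<^bsub>Op X\<^esub> u \<cdot>\<^bsub>Op X\<^esub> j) B" .
  then show ?thesis using that by simp
qed

end

section \<open>Condition (WIC)\<close>

text \<open>In an additive category it makes no difference whether split monomorphisms have cokernels or split epimorphisms
  have kernels: both say that the idempotent they define splits off a complement.\<close>

lemma weakly_idempotent_complete_Op:
  assumes "additive_category X" "weakly_idempotent_complete X"
  shows "weakly_idempotent_complete (Op X)"
proof -
  interpret additive_category X by fact
  interpret op: additive_category "Op X" using additive_category_Op assms(1) .
  have "\<exists>k. is_cokernel (Op X) f k" if "split_mono (Op X) f" for f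
  proof -
    from that obtain r where r: "r \<in> homs X (Cod X f) (Dom X f)" "f \<cdot>\<^bsub>X\<^esub> r = Ide X (Cod X f)"
      and f: "f \<in> homs X (Dom X f) (Cod X f)"
      by (auto simp: split_mono_def homs_iff)
    then have "split_mono X r" by (auto simp: split_mono_def homs_iff)
    then obtain k where "is_cokernel X r k" 
      using assms(2) by (auto simp: weakly_idempotent_complete_def)
    then obtain B j where "biproduct X (Cod X f) B (Dom X f) r j f k"
      using split_mono_cokernel_biproduct[OF r(1) f r(2)] by metis
    then have "biproduct (Op X) (Cod X f) B (Dom X f) f k r j" by simp
    then show ?thesis using op.biproduct_is_cokernel by blast
  qed
  then show ?thesis by (simp add: weakly_idempotent_complete_def)
qed

locale wic_extriangulated = extriangulated X for X :: "('o, 'm, 'e) extri" (structure) +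
  assumes wic: "weakly_idempotent_complete X"
begin

lemma wic_dual: "wic_extriangulated (Op X)"
  using dual weakly_idempotent_complete_Op[OF additive_category_axioms wic]
  by (simp add: wic_extriangulated_def wic_extriangulated_axioms_def)

text \<open>Let \<open>D\<close> be the cone of the inflation \<open>(f, 0) : A \<rightarrow> B \<oplus> C\<close>. The projection to \<open>C\<close> kills \<open>(f, 0)\<close>, so it
  factors through \<open>D\<close> and makes \<open>C\<close> a retract of \<open>D\<close>; by weak idempotent completeness \<open>D\<close> is a direct sum of \<open>C\<close> and some \<open>D'\<close>.
  The deflations \<open>B \<oplus> C \<rightarrow> D \<rightarrow> C\<close> compose to the projection, whose cocone is \<open>B\<close>, and the dual of
  (ET4) then fits the cocones into a conflation \<open>A \<rightarrow> B \<rightarrow> D'\<close>.\<close>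

lemma inflation_into_summand:
  assumes bp: "biproduct X B C P i j p q" and f: "f \<in> homs X A B"
    and t: "etriangle X \<epsilon> A (i \<cdot> f) P y D"
  obtains \<delta> D' y' where "etriangle X \<delta> A f B y' D'"
proof -
  note d = etriangleD[OF t] and b = biproductD[OF bp]
  have "q \<cdot> (i \<cdot> f) = Zer X A C" using Cmp_assoc[OF f b(4,7)] b(10) Zer_Cmp[OF f b(2)] by simp
  then obtain r where r: "r \<in> homs X D C" "r \<cdot> y = q"
    using factor_through_deflation[OF t b(7)] by metis
  note yj = Cmp_hom[OF b(5) d(2)]
  have ryj: "r \<cdot> (y \<cdot> j) = Ide X C" using Cmp_assoc[OF b(5) d(2) r(1)] r b(9) by simp
  then have "split_mono X (y \<cdot> j)" using yj r(1) by (auto simp: split_mono_def homs_iff)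
  then obtain k where "is_cokernel X (y \<cdot> j) k" 
    using wic by (auto simp: weakly_idempotent_complete_def)
  then obtain D' j' where "biproduct X C D' D (y \<cdot> j) j' r k"
    using split_mono_cokernel_biproduct[OF yj r(1) ryj] by metis
  note tr = etriangle_zero[OF biproduct_swap[OF this]]
  obtain E e g h' \<delta>'' where E: "e \<in> homs X E D'" "g \<in> homs X A E" "h' \<cdot> g = i \<cdot> f"
    "etriangle X \<delta>'' E h' P (r \<cdot> y) C" "etriangle X (pull X A j' \<epsilon>) A g E e D'"
    using etriangle_ET4_op[OF tr t] by metis
  obtain \<phi> where \<phi>: "\<phi> \<in> homs X E B" "is_iso X \<phi>" "i \<cdot> \<phi> = h'"
    using cocone_unique[OF etriangle_zero[OF bp] E(4)[unfolded r(2)]] .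
  have "i \<cdot> (\<phi> \<cdot> g) = i \<cdot> f" using Cmp_assoc[OF E(2) \<phi>(1) b(4)] \<phi> E by simp
  then have "(p \<cdot> i) \<cdot> (\<phi> \<cdot> g) = (p \<cdot> i) \<cdot> f"
    using Cmp_assoc[OF Cmp_hom[OF E(2) \<phi>(1)] b(4,6)] Cmp_assoc[OF f b(4,6)] by simp
  then have g: "\<phi> \<cdot> g = f" using b(8) Ide_Cmp[OF f] Ide_Cmp[OF Cmp_hom[OF E(2) \<phi>(1)]] by simp
  obtain \<psi> where \<psi>: "\<psi> \<in> homs X B E" "\<psi> \<cdot> \<phi> = Ide X E" using iso_obtain[OF \<phi>(2,1)] by metis
  have "(e \<cdot> \<psi>) \<cdot> \<phi> = e" using Cmp_assoc[OF \<phi>(1) \<psi>(1) E(1)] \<psi> Cmp_Ide[OF E(1)] by simp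
  from etriangle_change_middle[OF E(5) \<phi>(1,2) Cmp_hom[OF \<psi>(1) E(1)] this] show ?thesis
    using that g by simp
qed

text \<open>With \<open>g f\<close> also \<open>(f, g f) : A \<rightarrow> B \<oplus> C\<close> is an inflation, and a shear of \<open>B \<oplus> C\<close> turns it into \<open>(f, 0)\<close>.\<close>

lemma inflation_cancel:
  assumes f: "f \<in> homs X A B" and g: "g \<in> homs X B C" and t: "etriangle X \<epsilon> A (g \<cdot> f) C y D"
  obtains \<delta> D' y' where "etriangle X \<delta> A f B y' D'"
proof -
  obtain P i j p q where bp: "biproduct X B C P i j p q"
    using ex_biproduct[OF hom_obj[OF g]] by blast
  note b = biproductD[OF bp]
  obtain L l \<rho> where "etriangle X \<rho> A (i \<cdot> f \<boxplus> j \<cdot> (g \<cdot> f)) P l L"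
    using inflation_pair[OF t f bp] .
  also have "i \<cdot> f \<boxplus> j \<cdot> (g \<cdot> f) = (i \<boxplus> j \<cdot> g) \<cdot> f"
    using Add_Cmp[OF f b(4) Cmp_hom[OF g b(5)]] Cmp_assoc[OF f g b(5)] by simp
  finally show ?thesis
    using inflation_into_summand[OF biproduct_shear[OF bp g] f] that by metis
qed

end

section \<open>Classes of morphisms given by cones and cocones\<close>

lemma conflation_Op [simp]: "conflation (Op X) x y = conflation X y x"
  by (simp add: conflation_def)

lemma Infl_Op [simp]: "Infl (Op X) V = Defl X V"
  and Defl_Op [simp]: "Defl (Op X) U = Infl X U"
  by (simp_all add: Infl_def Defl_def inflation_def deflation_def is_Cone_def is_CoCone_def)

lemma lifts_Op [simp]: "lifts (Op X) l r = lifts X r l"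
proof -
  have *: "P \<longleftrightarrow> Q" if "\<And>f g. f \<in> F \<Longrightarrow> g \<in> G \<Longrightarrow> R f g \<longleftrightarrow> S g f" 
    "P \<longleftrightarrow> (\<forall>f\<in>F. \<forall>g\<in>G. R f g)" "Q \<longleftrightarrow> (\<forall>g\<in>G. \<forall>f\<in>F. S g f)" for P Q F G R S
    using that by blast
  show ?thesis
    unfolding lifts_def Op_simps homs_Op by (rule *[OF _ refl refl]) (auto simp: eq_commute)
qed

lemma llp_Op [simp]: "llp (Op X) M = rlp X M"
  and rlp_Op [simp]: "rlp (Op X) M = llp X M"
  by (simp_all add: llp_def rlp_def)

lemma weak_factorization_system_Op [simp]:
  "weak_factorization_system (Op X) R L = weak_factorization_system X L R"
proof -
  have "(\<exists>f\<in>R. \<exists>g\<in>L. Dom X f = Cod X g \<and> h = f \<cdot>\<^bsub>X\<^esub> g)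
    = (\<exists>f\<in>L. \<exists>g\<in>R. Cod X f = Dom X g \<and> h = g \<cdot>\<^bsub>X\<^esub> f)" for h
    by metis
  then show ?thesis by (auto simp: weak_factorization_system_def)
qed

lemma admissible_wfs_Op [simp]: "admissible_wfs (Op X) R L = admissible_wfs X L R"
  by (auto simp: admissible_wfs_def inflation_def deflation_def is_Cone_def is_CoCone_def)

lemma left_cancellation_Op [simp]: "left_cancellation (Op X) R = right_cancellation X R"
  by (simp add: left_cancellation_def right_cancellation_def) metis

lemma additive_subcategory_Op [simp]: "additive_subcategory (Op X) U = additive_subcategory X U"
proof -
  have "(\<exists>P\<in>U. \<exists>i j p q. biproduct X A B P p q i j) = (\<exists>P\<in>U. \<exists>i j p q. biproduct X A B P i j p q)" for A B
    by blast
  then show ?thesis by (simp add: additive_subcategory_def)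
qed

lemma summand_closed_Op [simp]: "summand_closed (Op X) U = summand_closed X U"
  by (simp add: summand_closed_def) blast

lemma object_class_Op [simp]: "category X \<Longrightarrow> object_class (Op X) U = object_class X U"
  by (simp add: object_class_def)

context extriangulated
begin

lemma conflation_iff: "conflation X x y \<longleftrightarrow> (\<exists>\<delta> A B C. etriangle X \<delta> A x B y C)"
  unfolding conflation_def using realizes_etriangle etriangle_def by metis

lemma etriangle_conflation: "etriangle X \<delta> A x B y C \<Longrightarrow> conflation X x y \<and> Dom X x = A \<and> Cod X x = B \<and> Cod X y = C"
  by (auto simp: conflation_def etriangle_def homs_iff)

lemma conflation_etriangle: "conflation X x y \<Longrightarrow> \<exists>\<delta>. etriangle X \<delta> (Dom X x) x (Cod X x) y (Cod X y)"
  unfolding conflation_def by (blast intro: realizes_etriangle)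

lemma cotorsion_pair_iff:
  "cotorsion_pair X U V \<longleftrightarrow>
     additive_subcategory X U \<and> iso_closed X U \<and> summand_closed X U \<and>
     additive_subcategory X V \<and> iso_closed X V \<and> summand_closed X V \<and>
     (\<forall>A \<in> U. \<forall>B \<in> V. carrier (Ext X A B) = {\<one>\<^bsub>Ext X A B\<^esub>}) \<and>
     (\<forall>C \<in> Obj X. \<exists>\<delta> A x B y. A \<in> V \<and> B \<in> U \<and> etriangle X \<delta> A x B y C) \<and>
     (\<forall>C \<in> Obj X. \<exists>\<delta> x B y D. B \<in> V \<and> D \<in> U \<and> etriangle X \<delta> C x B y D)"
proof -
  have 1: "(\<exists>x y. conflation X x y \<and> Dom X x \<in> V \<and> Cod X x \<in> U \<and> Cod X y = C)
    \<longleftrightarrow> (\<exists>\<delta> A x B y. A \<in> V \<and> B \<in> U \<and> etriangle X \<delta> A x B y C)" for C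
    using etriangle_conflation conflation_etriangle by metis
  have 2: "(\<exists>x y. conflation X x y \<and> Dom X x = C \<and> Cod X x \<in> V \<and> Cod X y \<in> U)
    \<longleftrightarrow> (\<exists>\<delta> x B y D. B \<in> V \<and> D \<in> U \<and> etriangle X \<delta> C x B y D)" for C
    using etriangle_conflation conflation_etriangle by metis
  show ?thesis unfolding cotorsion_pair_def 1 2 ..
qed

lemma hereditary_cotorsion_pair_iff:
  "hereditary_cotorsion_pair X U V \<longleftrightarrow> cotorsion_pair X U V \<and>
     (\<forall>\<delta> A x B y C. etriangle X \<delta> A x B y C \<longrightarrow> B \<in> U \<longrightarrow> C \<in> U \<longrightarrow> A \<in> U) \<and>
     (\<forall>\<delta> A x B y C. etriangle X \<delta> A x B y C \<longrightarrow> A \<in> V \<longrightarrow> B \<in> V \<longrightarrow> C \<in> V)"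
proof -
  have 1: "(\<forall>x y. conflation X x y \<longrightarrow> P (Dom X x) (Cod X x) (Cod X y))
    \<longleftrightarrow> (\<forall>\<delta> A x B y C. etriangle X \<delta> A x B y C \<longrightarrow> P A B C)" for P
    using etriangle_conflation conflation_etriangle by metis
  show ?thesis
    unfolding hereditary_cotorsion_pair_def
    using 1[of "\<lambda>A B C. B \<in> U \<longrightarrow> C \<in> U \<longrightarrow> A \<in> U"] 1[of "\<lambda>A B C. A \<in> V \<longrightarrow> B \<in> V \<longrightarrow> C \<in> V"]
    by simp
qed

lemma cotorsion_pair_Op: "cotorsion_pair (Op X) V U = cotorsion_pair X U V"
proof -
  interpret op: extriangulated "Op X" by (rule dual)
  have 1: "(\<exists>\<delta> A x B y. A \<in> U \<and> B \<in> V \<and> etriangle X \<delta> C y B x A)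
    \<longleftrightarrow> (\<exists>\<delta> x B y D. B \<in> V \<and> D \<in> U \<and> etriangle X \<delta> C x B y D)" for C
    by blast
  have 2: "(\<exists>\<delta> x B y D. B \<in> U \<and> D \<in> V \<and> etriangle X \<delta> D y B x C)
    \<longleftrightarrow> (\<exists>\<delta> A x B y. A \<in> V \<and> B \<in> U \<and> etriangle X \<delta> A x B y C)" for C
    by blast
  show ?thesis
    unfolding op.cotorsion_pair_iff cotorsion_pair_iff iso_closed_Op[OF category_axioms]
      additive_subcategory_Op summand_closed_Op etriangle_Op Op_simps 1 2 by blast
qed

lemma hereditary_cotorsion_pair_Op:
  "hereditary_cotorsion_pair (Op X) V U = hereditary_cotorsion_pair X U V"
proof -
  interpret op: extriangulated "Op X" by (rule dual)
  show ?thesis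
    unfolding op.hereditary_cotorsion_pair_iff hereditary_cotorsion_pair_iff cotorsion_pair_Op
      etriangle_Op by blast
qed

lemma mem_Infl: "f \<in> Infl X U \<longleftrightarrow> (\<exists>\<delta> A B y C. C \<in> U \<and> etriangle X \<delta> A f B y C)"
  unfolding Infl_def inflation_def is_Cone_def
  using etriangle_conflation conflation_etriangle by (auto; metis)

lemma mem_Defl: "f \<in> Defl X V \<longleftrightarrow> (\<exists>\<delta> A x B C. A \<in> V \<and> etriangle X \<delta> A x B f C)"
  using extriangulated.mem_Infl[OF dual, of f V] unfolding Infl_Op etriangle_Op by blast

lemma InflI: "etriangle X \<delta> A f B y C \<Longrightarrow> C \<in> U \<Longrightarrow> f \<in> Infl X U"
  using mem_Infl by blast

lemma InflE:
  assumes "f \<in> Infl X U" "f \<in> homs X A B"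
  obtains \<delta> y C where "C \<in> U" "etriangle X \<delta> A f B y C"
  using assms unfolding mem_Infl by (auto simp: etriangle_def homs_iff)

lemma DeflI: "etriangle X \<delta> A x B f C \<Longrightarrow> A \<in> V \<Longrightarrow> f \<in> Defl X V"
  using extriangulated.InflI[OF dual, of \<delta> C f B x A V] by simp

lemma DeflE:
  assumes "f \<in> Defl X V" "f \<in> homs X B C"
  obtains \<delta> x A where "A \<in> V" "etriangle X \<delta> A x B f C"
proof -
  have "f \<in> Infl (Op X) V" "f \<in> homs (Op X) C B" using assms by simp_all
  from extriangulated.InflE[OF dual this]
  obtain \<delta> x A where "A \<in> V" "etriangle (Op X) \<delta> C f B x A" .
  then show ?thesis using that by simp
qed

lemma Infl_Arr: "Infl X U \<subseteq> Arr X"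
  using mem_Infl by (auto simp: etriangle_def homs_iff)

text \<open>Objects are read off from morphisms here: \<open>C\<close> is the cone of \<open>0 \<rightarrow> C\<close>, and any other cone is isomorphic to it.\<close>

lemma Zer_mem_Infl_iff:
  assumes U: "iso_closed X U" and Z: "zero_object X Z" and C: "C \<in> Obj X"
  shows "Zer X Z C \<in> Infl X U \<longleftrightarrow> C \<in> U"
proof -
  have ZO: "Z \<in> Obj X" using Z by (simp add: zero_object_def)
  note t = etriangle_Ide_left[OF C Z]
  show ?thesis
  proof
    assume "Zer X Z C \<in> Infl X U"
    then obtain \<delta> y D where D: "D \<in> U" "etriangle X \<delta> Z (Zer X Z C) C y D"
      using InflE[OF _ Zer_hom[OF ZO C]] by metis
    from cone_unique[OF D(2) t] show "C \<in> U" using iso_closedD[OF U D(1)] by metis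
  qed (use InflI[OF t] in blast)
qed

lemma Infl_iff_cone:
  assumes U: "iso_closed X U"
  shows "f \<in> Infl X U \<longleftrightarrow>
     inflation X f \<and> (\<exists>C Z. is_Cone X f C \<and> zero_object X Z \<and> Zer X Z C \<in> Infl X U)"
proof -
  obtain Z where Z: "zero_object X Z" using ex_zero_object by blast
  have "C \<in> Obj X" if "is_Cone X f C" for C
    using that unfolding is_Cone_def conflation_iff using etriangleD(7) 
    by (metis etriangle_conflation)
  then show ?thesis using Zer_mem_Infl_iff[OF U] Z unfolding Infl_def by blast
qed

lemma Defl_iff_cocone:
  assumes "iso_closed X V"
  shows "f \<in> Defl X V \<longleftrightarrow>
     deflation X f \<and> (\<exists>A Z. is_CoCone X f A \<and> zero_object X Z \<and> Zer X A Z \<in> Defl X V)"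
  using extriangulated.Infl_iff_cone[OF dual, of V f] assms
  by (simp add: iso_closed_Op[OF category_axioms] inflation_def deflation_def is_Cone_def is_CoCone_def)

section \<open>Vanishing of extensions\<close>

lemma Ext_vanishD: "carrier (Ext X A B) = {\<one>\<^bsub>Ext X A B\<^esub>} \<Longrightarrow> e \<in> carrier (Ext X A B) \<Longrightarrow> e = \<one>\<^bsub>Ext X A B\<^esub>"
  by blast

lemma Ext_vanishI:
  "A \<in> Obj X \<Longrightarrow> B \<in> Obj X \<Longrightarrow> (\<And>e. e \<in> carrier (Ext X A B) \<Longrightarrow> e = \<one>\<^bsub>Ext X A B\<^esub>)
    \<Longrightarrow> carrier (Ext X A B) = {\<one>\<^bsub>Ext X A B\<^esub>}"
  using Ext_one by blast

lemma Ext_vanish_extension: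
  assumes t: "etriangle X \<delta> A x B y C" and V: "V \<in> Obj X"
    and A: "carrier (Ext X A V) = {\<one>\<^bsub>Ext X A V\<^esub>}" and C: "carrier (Ext X C V) = {\<one>\<^bsub>Ext X C V\<^esub>}"
  shows "carrier (Ext X B V) = {\<one>\<^bsub>Ext X B V\<^esub>}"
proof -
  note d = etriangleD[OF t]
  show ?thesis
  proof (rule Ext_vanishI[OF d(6) V])
    fix e assume e: "e \<in> carrier (Ext X B V)"
    then have "pull X V x e = \<one>\<^bsub>Ext X A V\<^esub>" using Ext_vanishD[OF A] pull_closed[OF e d(1) V] by blast
    then obtain e' where "e' \<in> carrier (Ext X C V)" "pull X V y e' = e"
      using pull_one_imp_pull[OF t V e] by metis
    then show "e = \<one>\<^bsub>Ext X B V\<^esub>" using Ext_vanishD[OF C] pull_one[OF d(2) V] by metis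
  qed
qed

lemma Ext_vanish_retract:
  assumes i: "i \<in> homs X A P" and p: "p \<in> homs X P A" and pi: "p \<cdot> i = Ide X A" and V: "V \<in> Obj X"
    and P: "carrier (Ext X P V) = {\<one>\<^bsub>Ext X P V\<^esub>}"
  shows "carrier (Ext X A V) = {\<one>\<^bsub>Ext X A V\<^esub>}"
proof (rule Ext_vanishI[OF hom_obj(1)[OF i] V])
  fix e assume e: "e \<in> carrier (Ext X A V)"
  have "e = pull X V i (pull X V p e)"
    using pull_Cmp[OF e p i V] pi pull_Ide[OF e V hom_obj(1)[OF i]] by simp
  also have "pull X V p e = \<one>\<^bsub>Ext X P V\<^esub>" using Ext_vanishD[OF P] pull_closed[OF e p V] by blast
  finally show "e = \<one>\<^bsub>Ext X A V\<^esub>" using pull_one[OF i V] by simp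
qed

text \<open>Closure under isomorphisms and summands comes from functoriality of \<open>E\<close>, closure under direct sums from its
  half-exactness. Each half of a cotorsion pair is of this form, the second one in the opposite category.\<close>

lemma left_orthogonal_class_closed:
  assumes V: "V \<subseteq> Obj X"
    and U: "U = {C \<in> Obj X. \<forall>B \<in> V. carrier (Ext X C B) = {\<one>\<^bsub>Ext X C B\<^esub>}}"
  shows "additive_subcategory X U \<and> iso_closed X U \<and> summand_closed X U"
proof (intro conjI)
  have ret: "A \<in> U" if "P \<in> U" "i \<in> homs X A P" "p \<in> homs X P A" "p \<cdot> i = Ide X A" for A P i p
    using Ext_vanish_retract[OF that(2-4)] that(1) V hom_obj[OF that(2)] unfolding U by blast
  show "summand_closed X U"
    unfolding summand_closed_def biproduct_def using ret by metis
  show "iso_closed X U"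
    unfolding iso_closed_def isomorphic_def using ret iso_obtain by metis
  obtain Z where Z: "zero_object X Z" using ex_zero_object by blast
  then have ZO: "Z \<in> Obj X" by (simp add: zero_object_def)
  have "carrier (Ext X Z B) = {\<one>\<^bsub>Ext X Z B\<^esub>}" if "B \<in> Obj X" for B
    using pull_Zer[OF _ that ZO ZO] pull_Ide[OF _ that ZO] zero_object_Ide[OF Z] 
    by (intro Ext_vanishI[OF ZO that]) simp
  then have "Z \<in> U" using V ZO U by blast
  moreover have "\<exists>P\<in>U. \<exists>i j p q. biproduct X A B P i j p q" if AB: "A \<in> U" "B \<in> U" for A B
  proof -
    obtain P i j p q where bp: "biproduct X A B P i j p q"
      using ex_biproduct AB unfolding U by blast
    have "P \<in> U" using Ext_vanish_extension[OF etriangle_zero[OF bp]] AB V biproductD(3)[OF bp] 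
      unfolding U by blast
    then show ?thesis using bp by blast
  qed
  moreover have "U \<subseteq> Obj X" using U by blast
  ultimately show "additive_subcategory X U" using Z unfolding additive_subcategory_def by blast
qed

lemma right_orthogonal_class_closed:
  assumes "U \<subseteq> Obj X"
    and "V = {C \<in> Obj X. \<forall>A \<in> U. carrier (Ext X A C) = {\<one>\<^bsub>Ext X A C\<^esub>}}"
  shows "additive_subcategory X V \<and> iso_closed X V \<and> summand_closed X V"
  using extriangulated.left_orthogonal_class_closed[OF dual, of U V] assms
  by (simp add: iso_closed_Op[OF category_axioms])

text \<open>The approximation \<open>A \<rightarrow> B \<rightarrow> C\<close> with \<open>A\<close> in \<open>V\<close> and \<open>B\<close> in \<open>U\<close> splits, so that \<open>C\<close> is a summand of \<open>B\<close>.\<close>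

lemma cotorsion_left_orthogonal:
  assumes cp: "cotorsion_pair X U V" and C: "C \<in> Obj X"
    and v: "\<And>B. B \<in> V \<Longrightarrow> carrier (Ext X C B) = {\<one>\<^bsub>Ext X C B\<^esub>}"
  shows "C \<in> U"
proof -
  obtain \<delta> A x B y where t: "A \<in> V" "B \<in> U" "etriangle X \<delta> A x B y C"
    using cp C unfolding cotorsion_pair_iff by metis
  have "\<delta> = \<one>\<^bsub>Ext X C A\<^esub>" using Ext_vanishD[OF v[OF t(1)]] etriangleD(3)[OF t(3)] .
  then obtain j p where "biproduct X A C B x j p y" using split_by_zero t(3) by metis
  then show ?thesis using cp t(2) unfolding cotorsion_pair_def summand_closed_def by blast
qed

lemma cotorsion_right_orthogonal:
  assumes "cotorsion_pair X U V" "C \<in> Obj X"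
    and "\<And>A. A \<in> U \<Longrightarrow> carrier (Ext X A C) = {\<one>\<^bsub>Ext X A C\<^esub>}"
  shows "C \<in> V"
  using extriangulated.cotorsion_left_orthogonal[OF dual, of V U C] assms cotorsion_pair_Op by simp

end

section \<open>Lifting and factorization\<close>

lemma liftsE:
  assumes lr: "lifts X l r" and l: "l \<in> homs X A B" and r: "r \<in> homs X C D"
    and fg: "f \<in> homs X A C" "g \<in> homs X B D" "Cmp X r f = Cmp X g l"
  obtains t where "t \<in> homs X B C" "Cmp X t l = f" "Cmp X r t = g"
proof -
  have D: "Dom X l = A" "Cod X l = B" "Dom X r = C" "Cod X r = D"
    using l r by (auto simp: homs_iff)
  show ?thesis using lr fg that unfolding lifts_def D by blast
qed

context extriangulated
begin

text \<open>Vanishing of \<open>E(U,V)\<close> is used twice. It makes \<open>E(U,C) \<rightarrow> E(U,D)\<close> injective, which lets \<open>f\<close>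
  extend along \<open>l\<close> because \<open>r f = g l\<close> does. The extension \<open>h\<close> solves the upper triangle only; the error \<open>g - r h\<close> of the lower one
  factors through \<open>U\<close>, and its lift along \<open>r\<close> is again obstructed by an element of \<open>E(U,V)\<close>.\<close>

lemma lifts_if_Ext_vanish:
  assumes t: "etriangle X \<delta> A l B l' U" and t': "etriangle X \<rho> V k C r D"
    and v: "carrier (Ext X U V) = {\<one>\<^bsub>Ext X U V\<^esub>}"
  shows "lifts X l r"
proof -
  note d = etriangleD[OF t] and d' = etriangleD[OF t']
  have "\<exists>t \<in> homs X B C. t \<cdot> l = f \<and> r \<cdot> t = g"
    if f: "f \<in> homs X A C" and g: "g \<in> homs X B D" and sq: "r \<cdot> f = g \<cdot> l" for f g
  proof -
    have "push X U r (push X U f \<delta>) = push X U (r \<cdot> f) \<delta>"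
      using push_Cmp[OF d(3) f d'(2) d(7)] by simp
    also have "\<dots> = push X U g (push X U l \<delta>)"
      using push_Cmp[OF d(3,1) g d(7)] sq by simp
    also have "\<dots> = \<one>\<^bsub>Ext X U D\<^esub>" using etriangle_push_one[OF t] push_one[OF g d(7)] by simp
    finally obtain \<epsilon> where \<epsilon>: "\<epsilon> \<in> carrier (Ext X U V)" "push X U k \<epsilon> = push X U f \<delta>"
      using push_one_imp_push[OF t' d(7) push_closed[OF d(3) f d(7)]] by metis
    then have "push X U f \<delta> = \<one>\<^bsub>Ext X U C\<^esub>"
      using Ext_vanishD[OF v] push_one[OF d'(1) d(7)] by metis
    then obtain h where h: "h \<in> homs X B C" "h \<cdot> l = f" using extend_along_inflation[OF t f] by metis
    note rh = Cmp_hom[OF h(1) d'(2)]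
    have "(g \<boxminus> r \<cdot> h) \<cdot> l = Zer X A D"
      using diff_Cmp[OF d(1) g rh] Cmp_assoc[OF d(1) h(1) d'(2)] h sq diff_self[OF Cmp_hom[OF d(1) g]]
      by simp
    then obtain s where s: "s \<in> homs X U D" "s \<cdot> l' = g \<boxminus> r \<cdot> h"
      using factor_through_deflation[OF t diff_hom[OF g rh]] by metis
    obtain s' where s': "s' \<in> homs X U C" "r \<cdot> s' = s"
      using lift_along_deflation[OF t' s(1)] Ext_vanishD[OF v] pull_closed[OF d'(3) s(1) d'(5)] by metis
    note sl = Cmp_hom[OF d(2) s'(1)]
    have "(h \<boxplus> s' \<cdot> l') \<cdot> l = f"
      using Add_Cmp[OF d(1) h(1) sl] Cmp_assoc[OF d(1,2) s'(1)] etriangle_Cmp_Zer[OF t]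
        Cmp_Zer[OF s'(1) d(5)] h Add_Zer[OF f] by simp
    moreover have "r \<cdot> (h \<boxplus> s' \<cdot> l') = g"
      using Cmp_Add[OF h(1) sl d'(2)] Cmp_assoc[OF d(2) s'(1) d'(2)] s s' 
        Add_commute[OF rh diff_hom[OF g rh]] diff_Add[OF g rh] by simp
    ultimately show ?thesis using Add_hom[OF h(1) sl] by blast
  qed
  then show ?thesis unfolding lifts_def using d d' by (auto simp: homs_iff)
qed

text \<open>The first object of a triangle may be replaced by an isomorphic one: composing \<open>A' \<rightarrow> A \<rightarrow> 0\<close> with
  the given triangle by (ET4) produces a cone that differs from \<open>C\<close> by an extension by \<open>0\<close>.\<close>

lemma inflation_Cmp_iso:
  assumes t: "etriangle X \<delta> A x B y C" and a: "a \<in> homs X A' A" "is_iso X a"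
  obtains \<delta>' y' C' e where "etriangle X \<delta>' A' (x \<cdot> a) B y' C'" "e \<in> homs X C' C" "is_iso X e"
proof -
  note d = etriangleD[OF t]
  obtain Z where Z: "zero_object X Z" using ex_zero_object by blast
  then have ZO: "Z \<in> Obj X" by (simp add: zero_object_def)
  note A' = hom_obj(1)[OF a(1)]
  have "Zer X A Z \<cdot> a = Zer X A' Z" using Zer_Cmp[OF a(1) ZO] .
  from etriangle_change_middle[OF etriangle_Ide_right[OF A' Z] a Zer_hom[OF d(5) ZO] this]
  have ta: "etriangle X \<one>\<^bsub>Ext X Z A'\<^esub> A' a A (Zer X A Z) Z" using Cmp_Ide[OF a(1)] by simp
  obtain E g e h \<delta>'' where E: "g \<in> homs X Z E" "e \<in> homs X E C" "etriangle X \<delta>'' A' (x \<cdot> a) B h E"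
    "etriangle X (push X C (Zer X A Z) \<delta>) Z g E e C"
    using etriangle_ET4[OF ta t] by metis
  note EO = hom_obj(1)[OF E(2)]
  obtain c where c: "c \<in> homs X E C" "is_iso X c" "c \<cdot> Ide X E = e"
    using cone_unique[OF etriangle_Ide_left[OF EO Z] E(4)[unfolded zero_object_hom_eq_Zer(1)[OF Z E(1)]]] .
  then show ?thesis using that[OF E(3,2)] Cmp_Ide[OF c(1)] by simp
qed

lemma push_eq_imp_pull:
  assumes t: "etriangle X \<delta> A x B y C" and T: "T \<in> Obj X"
    and e: "\<epsilon> \<in> carrier (Ext X T A)" "\<epsilon>' \<in> carrier (Ext X T A)" "push X T x \<epsilon> = push X T x \<epsilon>'"
  obtains c where "c \<in> homs X T C" "\<epsilon> = \<epsilon>' \<otimes>\<^bsub>Ext X T A\<^esub> pull X A c \<delta>"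
proof -
  note d = etriangleD[OF t]
  interpret G: comm_group "Ext X T A" using T d by (intro Ext_comm_group)
  interpret H: comm_group "Ext X T B" using T d by (intro Ext_comm_group)
  interpret group_hom "Ext X T A" "Ext X T B" "push X T x"
    using ExtMap_hom[OF Ide_hom[OF T] d(1)] unfolding push_def by unfold_locales
  define \<gamma> where "\<gamma> = inv\<^bsub>Ext X T A\<^esub> \<epsilon>' \<otimes>\<^bsub>Ext X T A\<^esub> \<epsilon>"
  have "\<gamma> \<in> carrier (Ext X T A)" "push X T x \<gamma> = \<one>\<^bsub>Ext X T B\<^esub>"
    unfolding \<gamma>_def using e by simp_all
  then obtain c where "c \<in> homs X T C" "pull X A c \<delta> = \<gamma>"
    using push_one_imp_pull[OF t T] by metis
  moreover have "\<epsilon> = \<epsilon>' \<otimes>\<^bsub>Ext X T A\<^esub> \<gamma>" unfolding \<gamma>_def using e by (simp add: G.m_assoc[symmetric])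
  ultimately show ?thesis using that by simp
qed

text \<open>The analogue of the pushout of \<open>A\<close> and \<open>V\<close> under \<open>K\<close>. Its object \<open>C\<close> is the middle term of a
  realization of \<open>i\<^sub>*\<delta>\<close>. By (ET4) the inflation \<open>K \<rightarrow> V \<rightarrow> C\<close> has as cone an extension of \<open>B\<close> by \<open>U\<close> with class \<open>k\<^sub>*i\<^sub>*\<delta> = 0\<close>,
  that is, \<open>U \<oplus> B\<close>. Cutting \<open>C\<close> along the projection from \<open>U \<oplus> B\<close> to \<open>U\<close> leaves an extension of \<open>B\<close> by \<open>K\<close>. For a suitable section of
  \<open>U \<oplus> B \<rightarrow> B\<close> its class is \<open>\<delta>\<close>, so that it is isomorphic to \<open>A\<close>. The cone of \<open>b\<close> is given up to isomorphism only, since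
  \<open>A\<close> is reached through such an isomorphism.\<close>

lemma conflation_pushout:
  assumes t: "etriangle X \<delta> K x A y B" and t': "etriangle X \<epsilon> K i V k U"
  obtains C b v where "b \<in> homs X A C" "v \<in> homs X C B" "v \<cdot> b = y"
    "\<exists>\<gamma> c U' e. etriangle X \<gamma> A b C c U' \<and> e \<in> homs X U' U \<and> is_iso X e"
    "\<exists>\<gamma> w. etriangle X \<gamma> V w C v B"
proof -
  note d = etriangleD[OF t] and d' = etriangleD[OF t']
  note p\<delta> = push_closed[OF d(3) d'(1) d(7)]
  obtain w C v where tv: "etriangle X (push X B i \<delta>) V w C v B"
    using etriangle_exists[OF d(7) d'(6) p\<delta>] .
  note dv = etriangleD[OF tv]
  obtain E g e h \<eta> where E: "g \<in> homs X U E" "e \<in> homs X E B" "h \<in> homs X C E"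
    "e \<cdot> h = v" "etriangle X \<eta> K (w \<cdot> i) C h E"
    "etriangle X (push X B k (push X B i \<delta>)) U g E e B" 
    "pull X K g \<eta> = \<epsilon>" "push X E i \<eta> = pull X V e (push X B i \<delta>)"
    using etriangle_ET4[OF t' tv] by metis
  note d\<eta> = etriangleD[OF E(5)]
  have "push X B k (push X B i \<delta>) = push X B (Zer X K U) \<delta>"
    using push_Cmp[OF d(3) d'(1,2) d(7)] etriangle_Cmp_Zer[OF t'] by simp
  then have "push X B k (push X B i \<delta>) = \<one>\<^bsub>Ext X B U\<^esub>"
    using push_Zer[OF d(3,5) d'(7) d(7)] by simp
  then obtain j q where "biproduct X U B E g j q e" using split_by_zero E(6) by metis
  then have j: "j \<in> homs X B E" "e \<cdot> j = Ide X B" by (auto simp: biproduct_def)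
  (* An arbitrary section j of e pulls eta back only to an extension that i identifies with delta;
     subtracting a map into U from j corrects the difference. *)
  have "push X B i (pull X K j \<eta>) = pull X V j (pull X V e (push X B i \<delta>))"
    using push_pull_commute[OF d\<eta>(3) d'(1) j(1)] E(8) by simp
  also have "\<dots> = push X B i \<delta>"
    using pull_Cmp[OF p\<delta> E(2) j(1) d'(6)] j(2) pull_Ide[OF p\<delta> d'(6) d(7)] by simp
  finally obtain m where m: "m \<in> homs X B U" "pull X K j \<eta> = \<delta> \<otimes>\<^bsub>Ext X B K\<^esub> pull X K m \<epsilon>"
    using push_eq_imp_pull[OF t' d(7) pull_closed[OF d\<eta>(3) j(1) d(5)] d(3)] by metis
  define s where "s = j \<boxminus> g \<cdot> m"
  note gm = Cmp_hom[OF m(1) E(1)]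
  have s: "s \<in> homs X B E" using diff_hom[OF j(1) gm] by (simp add: s_def)
  have "pull X K (g \<cdot> m) \<eta> = pull X K m \<epsilon>" using pull_Cmp[OF d\<eta>(3) E(1) m(1) d(5)] E(7) by simp
  then have "pull X K s \<eta> \<otimes>\<^bsub>Ext X B K\<^esub> pull X K m \<epsilon> = \<delta> \<otimes>\<^bsub>Ext X B K\<^esub> pull X K m \<epsilon>"
    using pull_Add[OF d\<eta>(3) s gm d(5)] diff_Add[OF j(1) gm] m(2) by (simp add: s_def)
  moreover have "comm_group (Ext X B K)" using d by (intro Ext_comm_group)
  ultimately have s\<eta>: "pull X K s \<eta> = \<delta>"
    using group.right_cancel[of "Ext X B K"] pull_closed[OF d\<eta>(3) s d(5)] 
      pull_closed[OF d'(3) m(1) d(5)] d(3) by (metis comm_group.axioms(2))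
  have "e \<cdot> s = Ide X B"
  proof -
    have "e \<cdot> (g \<cdot> m) = Zer X B B"
      using Cmp_assoc[OF m(1) E(1,2)] etriangle_Cmp_Zer[OF E(6)] Zer_Cmp[OF m(1) d(7)] by simp
    then show ?thesis
      unfolding s_def using Cmp_diff[OF j(1) gm E(2)] j(2) 
        diff_eqI[OF Ide_hom[OF d(7)] Zer_hom[OF d(7,7)] Ide_hom[OF d(7)]] 
        Add_Zer[OF Ide_hom[OF d(7)]] by simp
  qed
  note es = this
  then obtain q' where "biproduct X U B E g s q' e" using split_by_section[OF E(6) s] by metis
  note ts = etriangle_zero[OF biproduct_swap[OF this]]
  obtain A2 d2 e2 h2 \<gamma> where 2: "d2 \<in> homs X A2 B" "e2 \<in> homs X K A2" "h2 \<in> homs X A2 C"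
    "h \<cdot> h2 = s \<cdot> d2" "etriangle X \<gamma> A2 h2 C (q' \<cdot> h) U"
    "etriangle X (pull X K s \<eta>) K e2 A2 d2 B"
    using etriangle_ET4_op[OF ts E(5)] by metis
  obtain \<phi> where \<phi>: "\<phi> \<in> homs X A A2" "is_iso X \<phi>" "\<phi> \<cdot> x = e2" "d2 \<cdot> \<phi> = y"
    using etriangle_equiv[OF t 2(6)[unfolded s\<eta>]] .
  have "v \<cdot> (h2 \<cdot> \<phi>) = (e \<cdot> (h \<cdot> h2)) \<cdot> \<phi>"
    using E(4) Cmp_assoc[OF \<phi>(1) 2(3) dv(2)] Cmp_assoc[OF 2(3) E(3,2)] by simp
  also have "e \<cdot> (h \<cdot> h2) = d2"
    using 2(4) Cmp_assoc[OF 2(1) s E(2)] es Ide_Cmp[OF 2(1)] by simp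
  finally have "v \<cdot> (h2 \<cdot> \<phi>) = y" using \<phi>(4) by simp
  moreover have "\<exists>\<gamma> c U' e. etriangle X \<gamma> A (h2 \<cdot> \<phi>) C c U' \<and> e \<in> homs X U' U \<and> is_iso X e"
    using inflation_Cmp_iso[OF 2(5) \<phi>(1,2)] by metis
  ultimately show ?thesis using that[of "h2 \<cdot> \<phi>" C v] Cmp_hom[OF \<phi>(1) 2(3)] dv(2) tv by blast
qed

text \<open>The deflation \<open>(h, u)\<close> from \<open>A \<oplus> U\<^sub>1\<close> has some cocone \<open>K\<close>. The pushout along an inflation \<open>K \<rightarrow> V\<^sub>2\<close> with cone
  \<open>U\<^sub>2\<close> makes the cocone \<open>V\<^sub>2\<close>, and the resulting inflation out of \<open>A\<close> has as cone an extension of \<open>U\<^sub>2\<close> by \<open>U\<^sub>1\<close>, up to isomorphism.\<close>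

lemma cotorsion_factorization:
  assumes cp: "cotorsion_pair X U V" and h: "h \<in> homs X A B"
  obtains f g C where "f \<in> Infl X U" "g \<in> Defl X V" "f \<in> homs X A C" "g \<in> homs X C B" "h = g \<cdot> f"
proof -
  have isoU: "iso_closed X U" and UO: "U \<subseteq> Obj X" and VO: "V \<subseteq> Obj X"
    and van: "\<And>A B. A \<in> U \<Longrightarrow> B \<in> V \<Longrightarrow> carrier (Ext X A B) = {\<one>\<^bsub>Ext X A B\<^esub>}"
    using cp unfolding cotorsion_pair_def additive_subcategory_def by blast+
  obtain \<rho> V1 k U1 u where 1: "V1 \<in> V" "U1 \<in> U" "etriangle X \<rho> V1 k U1 u B"
    using cp hom_obj(2)[OF h] unfolding cotorsion_pair_iff by metis
  obtain P i j p q where bp: "biproduct X A U1 P i j p q"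
    using ex_biproduct[OF hom_obj(1)[OF h]] 1(2) UO by blast
  note b = biproductD[OF bp]
  let ?w = "h \<cdot> p \<boxplus> u \<cdot> q"
  obtain K l \<epsilon> where tw: "etriangle X \<epsilon> K l P ?w B" using deflation_pair[OF 1(3) h bp] .
  obtain \<delta> m V2 n U2 where 2: "V2 \<in> V" "U2 \<in> U" "etriangle X \<delta> K m V2 n U2"
    using cp etriangleD(5)[OF tw] unfolding cotorsion_pair_iff by metis
  obtain C c v \<gamma> y U' e \<gamma>' w where C: "c \<in> homs X P C" "v \<in> homs X C B" "v \<cdot> c = ?w"
    "etriangle X \<gamma> P c C y U'" "e \<in> homs X U' U2" "is_iso X e" "etriangle X \<gamma>' V2 w C v B"
    using conflation_pushout[OF tw 2(3)] by metis
  have U': "U' \<in> U"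
    using iso_closedD[OF isoU 2(2)] iso_obtain[OF C(6,5)] isoI C(5) by metis
  obtain E g f k' \<eta> where E: "etriangle X \<eta> A (c \<cdot> i) C k' E"
    "etriangle X (push X U' q \<gamma>) U1 g E f U'"
    using etriangle_ET4[OF etriangle_zero[OF bp] C(4)] by metis
  have "E \<in> U"
    by (rule cotorsion_left_orthogonal[OF cp etriangleD(6)[OF E(2)]])
      (use Ext_vanish_extension[OF E(2)] van U' 1(2) VO in blast)
  then have "c \<cdot> i \<in> Infl X U" using InflI[OF E(1)] by blast
  moreover have "v \<in> Defl X V" using DeflI[OF C(7) 2(1)] .
  moreover have "v \<cdot> (c \<cdot> i) = h"
    using Cmp_assoc[OF b(4) C(1,2)] C(3) Add_Cmp[OF b(4) Cmp_hom[OF b(6) h] Cmp_hom[OF b(7) etriangleD(2)[OF 1(3)]]]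
      Cmp_assoc[OF b(4,6) h] Cmp_assoc[OF b(4,7) etriangleD(2)[OF 1(3)]] b(8,10) Cmp_Ide[OF h]
      Cmp_Zer[OF etriangleD(2)[OF 1(3)] b(1)] Add_Zer[OF h] by simp
  ultimately show ?thesis using that C(2) etriangleD(1)[OF E(1)] by metis
qed

end

section \<open>From cotorsion pairs to weak factorization systems\<close>

context wic_extriangulated
begin

text \<open>The retract argument: factoring \<open>f = g l\<close> and lifting \<open>f\<close> against \<open>g\<close> gives a section \<open>t\<close> of \<open>g\<close> with
  \<open>t f = l\<close>. By Condition (WIC) \<open>f\<close> is an inflation, and since the cone of \<open>t\<close> is a summand of \<open>C\<close>, (ET4) presents the cone
  of \<open>l\<close> as an extension that splits, with the cone of \<open>f\<close> as a summand.\<close>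

lemma cotorsion_llp_subset:
  assumes cp: "cotorsion_pair X U V"
  shows "llp X (Defl X V) \<subseteq> Infl X U"
proof
  fix f assume "f \<in> llp X (Defl X V)"
  then obtain A B where f: "f \<in> homs X A B" and lp: "\<And>r. r \<in> Defl X V \<Longrightarrow> lifts X f r"
    by (auto simp: llp_def homs_iff)
  have isoU: "iso_closed X U" and sc: "summand_closed X U"
    using cp unfolding cotorsion_pair_def by blast+
  obtain l g C where lg: "l \<in> Infl X U" "g \<in> Defl X V" "l \<in> homs X A C" "g \<in> homs X C B" "f = g \<cdot> l"
    using cotorsion_factorization[OF cp f] .
  note BO = hom_obj(2)[OF f]
  have "g \<cdot> l = Ide X B \<cdot> f" using lg Ide_Cmp[OF f] by simp
  then obtain t where t: "t \<in> homs X B C" "t \<cdot> f = l" "g \<cdot> t = Ide X B"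
    using liftsE[OF lp[OF lg(2)] f lg(4,3) Ide_hom[OF BO]] by metis
  obtain \<delta> y W where W: "W \<in> U" "etriangle X \<delta> A l C y W" using InflE[OF lg(1,3)] .
  obtain \<epsilon> f' D where D: "etriangle X \<epsilon> A f B f' D"
    using inflation_cancel[OF f t(1)] W(2) t(2) by metis
  obtain \<rho> k V1 where "etriangle X \<rho> V1 k C g B" using DeflE[OF lg(2,4)] .
  then obtain p where "biproduct X V1 B C k t p g" using split_by_section t by metis
  note tt = etriangle_zero[OF biproduct_swap[OF this]]
  note DO = etriangleD(7)[OF D] and V1 = etriangleD(7)[OF tt]
  obtain E d e h \<eta> where E: "etriangle X \<eta> A (t \<cdot> f) C h E"
    "etriangle X (push X V1 f' \<one>\<^bsub>Ext X V1 B\<^esub>) D d E e V1"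
    using etriangle_ET4[OF D tt] by metis
  have "push X V1 f' \<one>\<^bsub>Ext X V1 B\<^esub> = \<one>\<^bsub>Ext X V1 D\<^esub>"
    using push_one[OF etriangleD(2)[OF D] V1] .
  then obtain j q where bp: "biproduct X D V1 E d j q e" using split_by_zero E(2) by metis
  obtain c where "c \<in> homs X W E" "is_iso X c"
    using cone_unique[OF W(2) E(1)[unfolded t(2)]] .
  then have "E \<in> U" using iso_closedD[OF isoU W(1)] by metis
  then have "D \<in> U" using sc bp unfolding summand_closed_def by blast
  then show "f \<in> Infl X U" using InflI[OF D] by blast
qed

lemma cotorsion_wfs:
  assumes cp: "cotorsion_pair X U V"
  shows "weak_factorization_system X (Infl X U) (Defl X V)"
proof -
  interpret op: wic_extriangulated "Op X" by (rule wic_dual)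
  have cp': "cotorsion_pair (Op X) V U" using cp cotorsion_pair_Op by simp
  have A: "Infl X U \<subseteq> Arr X" "Defl X V \<subseteq> Arr X"
    using Infl_Arr op.Infl_Arr[of V] by simp_all
  have "lifts X l r" if lU: "l \<in> Infl X U" and rV: "r \<in> Defl X V" for l r
  proof -
    obtain \<delta> A B y C where l: "C \<in> U" "etriangle X \<delta> A l B y C" using lU unfolding mem_Infl by blast
    obtain \<rho> D E x F where r: "F \<in> V" "etriangle X \<rho> F x E r D"
      using rV unfolding mem_Defl by blast
    show ?thesis using lifts_if_Ext_vanish[OF l(2) r(2)] cp l(1) r(1) by (simp add: cotorsion_pair_def)
  qed
  then have "Infl X U \<subseteq> llp X (Defl X V)" "Defl X V \<subseteq> rlp X (Infl X U)"
    using A by (auto simp: llp_def rlp_def)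
  moreover have "rlp X (Infl X U) \<subseteq> Defl X V"
    using op.cotorsion_llp_subset[OF cp'] by simp
  moreover have "\<exists>f\<in>Infl X U. \<exists>g\<in>Defl X V. Cod X f = Dom X g \<and> h = g \<cdot> f" if h: "h \<in> Arr X" for h
  proof -
    have "h \<in> homs X (Dom X h) (Cod X h)" using h by (simp add: homs_iff)
    then obtain f g C where "f \<in> Infl X U" "g \<in> Defl X V" "f \<in> homs X (Dom X h) C" 
      "g \<in> homs X C (Cod X h)" "h = g \<cdot> f" using cotorsion_factorization[OF cp] by metis
    moreover from this have "Cod X f = Dom X g" by (simp add: homs_iff)
    ultimately show ?thesis by blast
  qed
  ultimately show ?thesis 
    using A cotorsion_llp_subset[OF cp] unfolding weak_factorization_system_def by blast
qed

text \<open>The cones of \<open>\<alpha>\<close>, \<open>\<beta> \<alpha>\<close> and \<open>\<beta>\<close> form a conflation by (ET4) once \<open>\<alpha>\<close> is known to be an inflation, which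
  is Condition (WIC); then \<open>U\<close> contains the first cone because it contains the other two.\<close>

lemma hereditary_left_cancellation:
  assumes h: "hereditary_cotorsion_pair X U V"
  shows "left_cancellation X (Infl X U)"
  unfolding left_cancellation_def
proof (intro ballI impI)
  fix a b assume a: "a \<in> Arr X" and b: "b \<in> Arr X" and ab: "Cod X a = Dom X b"
    and ba: "b \<cdot> a \<in> Infl X U" and bU: "b \<in> Infl X U"
  have isoU: "iso_closed X U" using h by (simp add: hereditary_cotorsion_pair_def cotorsion_pair_def)
  define A B C where "A = Dom X a" and "B = Cod X a" and "C = Cod X b"
  have ha: "a \<in> homs X A B" and hb: "b \<in> homs X B C" 
    using a b ab by (auto simp: A_def B_def C_def homs_iff)
  obtain \<delta> y W where W: "W \<in> U" "etriangle X \<delta> A (b \<cdot> a) C y W"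
    using InflE[OF ba Cmp_hom[OF ha hb]] .
  obtain \<epsilon> z F where F: "F \<in> U" "etriangle X \<epsilon> B b C z F" using InflE[OF bU hb] .
  obtain \<rho> a' D where D: "etriangle X \<rho> A a B a' D" using inflation_cancel[OF ha hb W(2)] .
  obtain E d e h' \<eta> where E: "etriangle X \<eta> A (b \<cdot> a) C h' E"
    "etriangle X (push X F a' \<epsilon>) D d E e F"
    using etriangle_ET4[OF D F(2)] by metis
  obtain c where "c \<in> homs X W E" "is_iso X c" using cone_unique[OF W(2) E(1)] .
  then have "E \<in> U" using iso_closedD[OF isoU W(1)] by metis
  then have "D \<in> U" using h E(2) F(1) unfolding hereditary_cotorsion_pair_iff by blast
  then show "a \<in> Infl X U" using InflI[OF D] by blast
qed

end

section \<open>From weak factorization systems to cotorsion pairs\<close>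

context extriangulated
begin

text \<open>A lift of the identity of \<open>A\<close> in the square from \<open>0 \<rightarrow> A\<close> to the deflation of a triangle \<open>B \<rightarrow> M \<rightarrow> A\<close> is a section.\<close>

lemma wfs_Ext_vanish:
  assumes wfs: "weak_factorization_system X (Infl X U) (Defl X V)"
    and oc: "object_class X U" "object_class X V" and A: "A \<in> U" and B: "B \<in> V"
  shows "carrier (Ext X A B) = {\<one>\<^bsub>Ext X A B\<^esub>}"
proof -
  have O: "A \<in> Obj X" "B \<in> Obj X" and isoU: "iso_closed X U" 
    using oc A B by (auto simp: object_class_def)
  obtain Z where Z: "zero_object X Z" using ex_zero_object by blast
  then have ZO: "Z \<in> Obj X" by (simp add: zero_object_def)
  show ?thesis
  proof (rule Ext_vanishI[OF O])
    fix e assume e: "e \<in> carrier (Ext X A B)"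
    obtain x M y where t: "etriangle X e B x M y A" using etriangle_exists[OF O e] .
    note d = etriangleD[OF t]
    note z = Zer_hom[OF ZO O(1)] and zM = Zer_hom[OF ZO d(6)]
    have "Zer X Z A \<in> Infl X U" using Zer_mem_Infl_iff[OF isoU Z O(1)] A by blast
    moreover have "y \<in> Defl X V" using DeflI[OF t B] .
    ultimately have "lifts X (Zer X Z A) y" 
      using wfs unfolding weak_factorization_system_def llp_def by blast
    moreover have "y \<cdot> Zer X Z M = Ide X A \<cdot> Zer X Z A"
      using Cmp_Zer[OF d(2) ZO] Ide_Cmp[OF z] by simp
    ultimately obtain s where s: "s \<in> homs X A M" "y \<cdot> s = Ide X A"
      using liftsE[OF _ z d(2) zM Ide_hom[OF O(1)]] by metis
    show "e = \<one>\<^bsub>Ext X A B\<^esub>"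
      using pull_Cmp[OF e d(2) s(1) O(2)] s(2) pull_Ide[OF e O(2,1)] etriangle_pull_one[OF t]
        pull_one[OF s(1) O(2)] by simp
  qed
qed

lemma wfs_left_orthogonal:
  assumes wfs: "weak_factorization_system X (Infl X U) (Defl X V)"
    and oc: "object_class X U" and C: "C \<in> Obj X"
    and v: "\<And>B. B \<in> V \<Longrightarrow> carrier (Ext X C B) = {\<one>\<^bsub>Ext X C B\<^esub>}"
  shows "C \<in> U"
proof -
  have isoU: "iso_closed X U" using oc by (simp add: object_class_def)
  obtain Z where Z: "zero_object X Z" using ex_zero_object by blast
  then have ZO: "Z \<in> Obj X" by (simp add: zero_object_def)
  have "lifts X (Zer X Z C) r" if r: "r \<in> Defl X V" for r
  proof -
    obtain \<rho> D E x F where "F \<in> V" "etriangle X \<rho> F x E r D"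
      using r unfolding mem_Defl by blast
    then show ?thesis using lifts_if_Ext_vanish[OF etriangle_Ide_left[OF C Z]] v by blast
  qed
  then have "Zer X Z C \<in> llp X (Defl X V)"
    using Zer_hom[OF ZO C] by (auto simp: llp_def homs_iff)
  then have "Zer X Z C \<in> Infl X U" using wfs by (simp add: weak_factorization_system_def)
  then show ?thesis using Zer_mem_Infl_iff[OF isoU Z C] by blast
qed

lemma wfs_left_orthogonal_class:
  assumes wfs: "weak_factorization_system X (Infl X U) (Defl X V)"
    and oc: "object_class X U" "object_class X V"
  shows "U = {C \<in> Obj X. \<forall>B \<in> V. carrier (Ext X C B) = {\<one>\<^bsub>Ext X C B\<^esub>}}"
  using wfs_left_orthogonal[OF wfs oc(1)] wfs_Ext_vanish[OF assms] oc 
  unfolding object_class_def by blast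

text \<open>The factorization of \<open>0 \<rightarrow> C\<close> passes through its approximation by an object of \<open>U\<close>.\<close>

lemma wfs_approximation:
  assumes wfs: "weak_factorization_system X (Infl X U) (Defl X V)"
    and oc: "object_class X U" and C: "C \<in> Obj X"
  shows "\<exists>\<delta> A x B y. A \<in> V \<and> B \<in> U \<and> etriangle X \<delta> A x B y C"
proof -
  have isoU: "iso_closed X U" using oc by (simp add: object_class_def)
  obtain Z where Z: "zero_object X Z" using ex_zero_object by blast
  then have ZO: "Z \<in> Obj X" by (simp add: zero_object_def)
  note z = Zer_hom[OF ZO C]
  obtain f g where fg: "f \<in> Infl X U" "g \<in> Defl X V" "Cod X f = Dom X g" "Zer X Z C = g \<cdot> f"
    using wfs z unfolding weak_factorization_system_def homs_iff by metis
  have Ar: "f \<in> Arr X" "g \<in> Arr X" using wfs fg unfolding weak_factorization_system_def by blast+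
  define W where "W = Cod X f"
  have "f \<in> homs X (Dom X f) W" "g \<in> homs X W (Cod X g)" using Ar fg by (auto simp: W_def homs_iff)
  moreover from this have "g \<cdot> f \<in> homs X (Dom X f) (Cod X g)" using Cmp_hom by blast
  ultimately have h: "f \<in> homs X Z W" "g \<in> homs X W C" using z fg(4) by (auto simp: homs_iff)
  have "W \<in> U"
    using Zer_mem_Infl_iff[OF isoU Z hom_obj(2)[OF h(1)]] fg(1) zero_object_hom_eq_Zer(1)[OF Z h(1)] 
    by simp
  then show ?thesis using DeflE[OF fg(2) h(2)] by metis
qed

lemma wfs_cotorsion:
  assumes wfs: "weak_factorization_system X (Infl X U) (Defl X V)"
    and oc: "object_class X U" "object_class X V"
  shows "cotorsion_pair X U V"
proof -
  interpret op: extriangulated "Op X" by (rule dual)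
  have wfs': "weak_factorization_system (Op X) (Infl (Op X) V) (Defl (Op X) U)" using wfs by simp
  have oc': "object_class (Op X) U" "object_class (Op X) V" using oc category_axioms by simp_all
  have "additive_subcategory X U \<and> iso_closed X U \<and> summand_closed X U"
    using left_orthogonal_class_closed[OF _ wfs_left_orthogonal_class[OF wfs oc]] oc
    by (simp add: object_class_def)
  moreover have "V = {C \<in> Obj X. \<forall>A \<in> U. carrier (Ext X A C) = {\<one>\<^bsub>Ext X A C\<^esub>}}"
    using op.wfs_left_orthogonal_class[OF wfs' oc'(2,1)] by simp
  then have "additive_subcategory X V \<and> iso_closed X V \<and> summand_closed X V"
    using right_orthogonal_class_closed oc by (simp add: object_class_def)
  moreover have "\<exists>\<delta> x B y D. B \<in> V \<and> D \<in> U \<and> etriangle X \<delta> C x B y D" if "C \<in> Obj X" for C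
    using op.wfs_approximation[OF wfs' oc'(2), of C] that by simp blast
  ultimately show ?thesis
    using wfs_Ext_vanish[OF wfs oc] wfs_approximation[OF wfs oc(1)] unfolding cotorsion_pair_iff by blast
qed

text \<open>For \<open>A \<rightarrow> B \<rightarrow> C\<close> with \<open>A\<close> and \<open>B\<close> in \<open>V\<close>, an extension \<open>e\<close> of an object \<open>T\<close> of \<open>U\<close> by \<open>C\<close> vanishes by dimension
  shifting. Covering the middle term of \<open>e\<close> by an object of \<open>U\<close> expresses \<open>e\<close> as \<open>n\<^sub>*\<eta>\<close> for some \<open>n : N \<rightarrow> C\<close>, where \<open>N\<close> is the cocone of a
  deflation between objects of \<open>U\<close> and thus lies in \<open>U\<close>. So \<open>n\<close> lifts to \<open>m : N \<rightarrow> B\<close>, and \<open>e = y\<^sub>*m\<^sub>*\<eta>\<close> with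
  \<open>m\<^sub>*\<eta>\<close> in \<open>E(T,B) = 0\<close>.\<close>

lemma cotorsion_hereditary:
  assumes cp: "cotorsion_pair X U V"
    and hU: "\<And>\<delta> A x B y C. etriangle X \<delta> A x B y C \<Longrightarrow> B \<in> U \<Longrightarrow> C \<in> U \<Longrightarrow> A \<in> U"
  shows "hereditary_cotorsion_pair X U V"
proof -
  have "C \<in> V" if t: "etriangle X \<delta> A x B y C" and A: "A \<in> V" and B: "B \<in> V" for \<delta> A x B y C
  proof (rule cotorsion_right_orthogonal[OF cp])
    note d = etriangleD[OF t]
    show CO: "C \<in> Obj X" by (fact d(7))
    have van: "\<And>A B. A \<in> U \<Longrightarrow> B \<in> V \<Longrightarrow> carrier (Ext X A B) = {\<one>\<^bsub>Ext X A B\<^esub>}"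
      using cp by (simp add: cotorsion_pair_def)
    fix T assume T: "T \<in> U"
    have TO: "T \<in> Obj X" using cp T unfolding cotorsion_pair_def additive_subcategory_def by blast
    show "carrier (Ext X T C) = {\<one>\<^bsub>Ext X T C\<^esub>}"
    proof (rule Ext_vanishI[OF TO CO])
      fix e assume e: "e \<in> carrier (Ext X T C)"
      obtain f M g where M: "etriangle X e C f M g T" using etriangle_exists[OF TO CO e] .
      obtain \<epsilon> V1 k U1 u where U1: "U1 \<in> U" "etriangle X \<epsilon> V1 k U1 u M"
        using cp etriangleD(6)[OF M] unfolding cotorsion_pair_iff by metis
      obtain N n h \<eta> where N: "n \<in> homs X N C" "etriangle X \<eta> N h U1 (g \<cdot> u) T" "push X T n \<eta> = e"
        using etriangle_ET4_op[OF M U1(2)] by metis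
      have NU: "N \<in> U" using hU[OF N(2) U1(1) T] .
      note \<eta> = etriangleD(3)[OF N(2)]
      obtain m where m: "m \<in> homs X N B" "y \<cdot> m = n"
        using lift_along_deflation[OF t N(1)] Ext_vanishD[OF van[OF NU A]] 
          pull_closed[OF d(3) N(1) d(5)] by metis
      have "push X T m \<eta> = \<one>\<^bsub>Ext X T B\<^esub>"
        using Ext_vanishD[OF van[OF T B]] push_closed[OF \<eta> m(1) TO] by blast
      then show "e = \<one>\<^bsub>Ext X T C\<^esub>"
        using N(3) m(2) push_Cmp[OF \<eta> m(1) d(2) TO] push_one[OF d(2) TO] by simp
    qed
  qed
  then show ?thesis using cp hU unfolding hereditary_cotorsion_pair_iff by blast
qed

end

section \<open>The equivalences\<close>

context wic_extriangulated
begin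

lemma hereditary_iff_admissible_left_cancellation:
  assumes oc: "object_class X U" "object_class X V"
  shows "hereditary_cotorsion_pair X U V \<longleftrightarrow>
    admissible_wfs X (Infl X U) (Defl X V) \<and> left_cancellation X (Infl X U)"
proof
  assume h: "hereditary_cotorsion_pair X U V"
  then have "weak_factorization_system X (Infl X U) (Defl X V)"
    using cotorsion_wfs by (simp add: hereditary_cotorsion_pair_def)
  then have "admissible_wfs X (Infl X U) (Defl X V)"
    unfolding admissible_wfs_def
    using Infl_iff_cone[of U] Defl_iff_cocone[of V] oc unfolding object_class_def by blast
  then show "admissible_wfs X (Infl X U) (Defl X V) \<and> left_cancellation X (Infl X U)"
    using hereditary_left_cancellation[OF h] by blast
next
  assume a: "admissible_wfs X (Infl X U) (Defl X V) \<and> left_cancellation X (Infl X U)"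
  then have wfs: "weak_factorization_system X (Infl X U) (Defl X V)" by (simp add: admissible_wfs_def)
  have isoU: "iso_closed X U" using oc by (simp add: object_class_def)
  show "hereditary_cotorsion_pair X U V"
  proof (rule cotorsion_hereditary[OF wfs_cotorsion[OF wfs oc]])
    fix \<delta> A x B y C assume t: "etriangle X \<delta> A x B y C" and B: "B \<in> U" and C: "C \<in> U"
    note d = etriangleD[OF t]
    obtain Z where Z: "zero_object X Z" using ex_zero_object by blast
    then have ZO: "Z \<in> Obj X" by (simp add: zero_object_def)
    have "x \<cdot> Zer X Z A \<in> Infl X U"
      using Cmp_Zer[OF d(1) ZO] Zer_mem_Infl_iff[OF isoU Z d(6)] B by simp
    moreover have "x \<in> Infl X U" using InflI[OF t C] .
    ultimately have "Zer X Z A \<in> Infl X U"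
      using a Zer_hom[OF ZO d(5)] d(1) unfolding left_cancellation_def homs_iff by blast
    then show "A \<in> U" using Zer_mem_Infl_iff[OF isoU Z d(5)] by blast
  qed
qed

end

theorem theorem3p15:
  fixes X :: "('o, 'm, 'e) extri" and U V :: "'o set"
  assumes "extriangulated_category X"
    and "weakly_idempotent_complete X"
    and "object_class X U" and "object_class X V"
  shows "(hereditary_cotorsion_pair X U V \<longleftrightarrow>
            admissible_wfs X (Infl X U) (Defl X V) \<and> left_cancellation X (Infl X U)) \<and>
         (hereditary_cotorsion_pair X U V \<longleftrightarrow>
            admissible_wfs X (Infl X U) (Defl X V) \<and> right_cancellation X (Defl X V))"
proof -
  interpret wic_extriangulated X
    using assms by (simp add: wic_extriangulated_def wic_extriangulated_axioms_def extriangulated_def)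
  interpret op: wic_extriangulated "Op X" by (rule wic_dual)
  show ?thesis
    using hereditary_iff_admissible_left_cancellation[of U V] assms(3,4)
      op.hereditary_iff_admissible_left_cancellation[of V U] hereditary_cotorsion_pair_Op[of V U]
    by (simp add: category_axioms)
qed

end
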